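(* For real $x$, let $B(x) = \sum_{n \leq x} \operatorname{sopfr}(n)$, where the sum runs over all positive integers $n \le x$ and $\operatorname{sopfr}(n)$ is the sum of the prime factors of $n$ counted with multiplicity, and let $P(x) = \sum_{p \leq x} p$, where the sum runs over all primes $p \le x$. Then, as $x \to \infty$, $$B(x) \sim \frac{\pi^2}{6}\, P(x).$$
   Context: For an integer $n > 1$ with prime factorization $n = \prod_{i=1}^r p_i^{\alpha_i}$ (the $p_i$ distinct primes, $\alpha_i \ge 1$ their multiplicities), $\operatorname{sopfr}(n) = \sum_{i=1}^r \alpha_i p_i$, and $\operatorname{sopfr}(1) = 0$. The notation $F(x) \sim G(x)$ means $\lim_{x \to \infty} F(x)/G(x) = 1$. Here $\pi$ is the usual constant $3.14159\ldots$. *)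

theory Defs
  imports Complex_Main "HOL-Computational_Algebra.Primes"
begin

definition sopfr :: "nat \<Rightarrow> nat" where
  "sopfr n = (\<Sum>p\<in>prime_factors n. multiplicity p n * p)"

lemma sopfr_1: "sopfr 1 = 0"
  by (simp add: sopfr_def)

definition sopfr_sum :: "real \<Rightarrow> real" where
  "sopfr_sum x = (\<Sum>n | 1 \<le> n \<and> real n \<le> x. real (sopfr n))"

definition prime_sum :: "real \<Rightarrow> real" where
  "prime_sum x = (\<Sum>p | prime p \<and> real p \<le> x. real p)"

end

theory Submission
  imports Defs "HOL-Complex_Analysis.Complex_Analysis" "HOL-Number_Theory.Prime_Powers" "HOL-Real_Asymp.Real_Asymp"
begin

text \<open>
  Write \<open>P x\<close> for \<open>prime_sum x\<close>. The argument rests on the prime number theorem, in the form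
  \<open>P x \<sim> x\<^sup>2 / (2 ln x)\<close> (\<open>prime_sum_asymptotics\<close>). Granting it, the corollary is a
  dominated convergence argument. Write each \<open>n \<le> x\<close> that is divisible by a prime \<open>p\<close> as
  \<open>n = m p\<close>: the sum over \<open>n \<le> x\<close> of the distinct prime factors of \<open>n\<close> is the sum of
  \<open>P (x / m)\<close> over \<open>m \<ge> 1\<close>. For fixed \<open>m\<close> the quotient \<open>P (x / m) / P x\<close> tends to
  \<open>1 / m\<^sup>2\<close>, and it is at most a constant times \<open>m powr (-3/2)\<close> for all \<open>m\<close> and all large \<open>x\<close>
  (\<open>prime_sum_quotient_bound\<close>, with \<open>x\<^sup>2 / ln x\<close> in place of \<open>P x\<close>), so Tannery's theorem gives the factor
  \<open>\<Sum> 1 / m\<^sup>2 = pi\<^sup>2 / 6\<close>. Counting prime factors with multiplicity changes the term for \<open>n\<close> by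
  at most \<open>sqrt n * log 2 n\<close> (\<open>sopfr_minus_sum_prime_factors\<close>), which is negligible after
  summation.

  The prime number theorem cannot be bypassed. If the corollary holds, then every limit \<open>g\<close> of
  translates of \<open>t \<mapsto> t * P (exp t) / exp (2 * t)\<close> is invariant under averaging over the
  translations by \<open>ln m\<close> with weights proportional to \<open>1 / m\<^sup>2\<close>, hence constant, and
  Mertens' estimate determines the constant.

  The proof of the prime number theorem is Newman's. The function \<open>(s - 1) \<zeta>(s)\<close> is continued to
  \<open>Re s > 0\<close> by comparing the terms of the series for \<open>\<zeta>\<close> with integrals over unit intervals.
  It has no zero with \<open>Re s \<ge> 1\<close> (\<open>zeta_reg_nonzero\<close>), by the classical inequality
  \<open>3 + 4 cos \<phi> + cos (2 \<phi>) \<ge> 0\<close>. Consequently the Dirichlet series with the bounded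
  coefficients \<open>(\<psi> n - n) / n\<close> extends holomorphically across the line \<open>Re s = 1\<close>, where
  \<open>\<psi>\<close> is Chebyshev's function. The Tauberian theorem \<open>newman_ingham\<close> then says that
  \<open>\<Sum> (\<psi> n - n) / n\<^sup>2\<close> converges, and since \<open>\<psi>\<close> is monotone this forces
  \<open>\<psi> n \<sim> n\<close>. The asymptotics of \<open>P\<close> follow by partial summation.
\<close>

section \<open>Analytic preliminaries\<close>

text \<open>
  The form of Weierstrass' theorem needed for Dirichlet series: these converge uniformly only on
  smaller half planes, so the dominating series may depend on the point.
\<close>

lemma series_and_derivative_locally_dominated:
  fixes f :: "nat \<Rightarrow> complex \<Rightarrow> complex"
  assumes S: "open S" and hol: "\<And>n. f n holomorphic_on S"
    and dom: "\<And>x. x \<in> S \<Longrightarrow> \<exists>d>0. \<exists>h. summable h \<and> (\<forall>n. \<forall>y\<in>ball x d \<inter> S. norm (f n y) \<le> h n)"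
  shows "(\<lambda>z. \<Sum>n. f n z) holomorphic_on S"
    and "\<And>z. z \<in> S \<Longrightarrow> (\<lambda>n. deriv (f n) z) sums deriv (\<lambda>z. \<Sum>n. f n z) z"
proof -
  have "\<exists>g g'. \<forall>x\<in>S. (\<lambda>n. f n x) sums g x \<and> (\<lambda>n. deriv (f n) x) sums g' x
                     \<and> (g has_field_derivative g' x) (at x)"
  proof (rule series_and_derivative_comparison_local [OF S])
    show "(f n has_field_derivative deriv (f n) x) (at x)" if "x \<in> S" for n x
      using holomorphic_derivI[OF hol S that] .
    show "\<exists>d h. 0 < d \<and> summable h \<and> (\<forall>\<^sub>F n in sequentially. \<forall>y\<in>ball x d \<inter> S. norm (f n y) \<le> h n)"
      if "x \<in> S" for x
      proof -
      from dom[OF that] obtain d h where "d > 0" "summable h" "\<forall>n. \<forall>y\<in>ball x d \<inter> S. norm (f n y) \<le> h n"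
        by (elim exE conjE) (rule that)
      thus ?thesis by (intro exI[of _ d] exI[of _ h] conjI always_eventually)
    qed
  qed
  then obtain g g' where gg: "\<forall>x\<in>S. (\<lambda>n. f n x) sums g x \<and> (\<lambda>n. deriv (f n) x) sums g' x
                     \<and> (g has_field_derivative g' x) (at x)"
    by (elim exE) (rule that)
  have g: "(\<lambda>n. f n x) sums g x" "(\<lambda>n. deriv (f n) x) sums g' x"
    "(g has_field_derivative g' x) (at x)" if "x \<in> S" for x
    using bspec[OF gg that] by simp_all
  have D: "((\<lambda>z. \<Sum>n. f n z) has_field_derivative g' x) (at x)" if "x \<in> S" for x
    by (rule has_field_derivative_transform_within_open[OF g(3)[OF that] S that])
       (rule sums_unique[OF g(1)])
  show "(\<lambda>z. \<Sum>n. f n z) holomorphic_on S"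
    unfolding holomorphic_on_open[OF S] using D by (intro ballI exI)
  show "(\<lambda>n. deriv (f n) z) sums deriv (\<lambda>z. \<Sum>n. f n z) z" if "z \<in> S" for z
    using g(2)[OF that] DERIV_imp_deriv[OF D[OF that]] by simp
qed

lemma powr_diff_mean_value:
  fixes a y :: real
  assumes "0 < a"
  obtains \<xi> where "a < \<xi>" "\<xi> < a + 1" "(a + 1) powr y - a powr y = y * \<xi> powr (y - 1)"
proof -
  have "\<exists>z. a < z \<and> z < a + 1 \<and> (a + 1) powr y - a powr y = (a + 1 - a) * (y * z powr (y - 1))"
    by (rule MVT2) (use assms in \<open>auto intro!: derivative_eq_intros\<close>)
  thus ?thesis using that by auto
qed

text \<open>
  Comparison with the integral of \<open>t powr (y - 1)\<close>. The bound uses \<open>Suc N\<close> rather than \<open>N\<close>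
  because the integrand is increasing for \<open>y \<ge> 1\<close> and decreasing for \<open>y \<le> 1\<close>: one bound then
  covers both cases, and its base is the one that occurs in Newman's kernel below.
\<close>

lemma sum_powr_le:
  fixes y :: real
  assumes "y > 0"
  shows "(\<Sum>n<N. real (Suc n) powr (y - 1)) \<le> real (Suc N) powr y / y"
proof (cases "y \<ge> 1")
  case True
  have step: "real (Suc N) powr (y - 1) \<le> real (Suc (Suc N)) powr y / y - real (Suc N) powr y / y" for N
  proof -
    obtain \<xi> where \<xi>: "real (Suc N) < \<xi>" "(real (Suc N) + 1) powr y - real (Suc N) powr y = y * \<xi> powr (y - 1)"
      using powr_diff_mean_value[of "real (Suc N)" y] by auto
    have "real (Suc N) powr (y - 1) \<le> \<xi> powr (y - 1)"
      using \<xi>(1) True by (intro powr_mono2) auto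
    also have "\<dots> = (real (Suc (Suc N)) powr y - real (Suc N) powr y) / y"
      using \<xi>(2) assms by (simp add: add_ac)
    finally show ?thesis by (simp only: diff_divide_distrib)
  qed
  show ?thesis
  proof (induction N)
    case 0 show ?case using assms by simp
  next
    case (Suc N)
    thus ?case using step[of N] by simp
  qed
next
  case False
  have step: "real (Suc N) powr (y - 1) \<le> real (Suc N) powr y / y - real N powr y / y" for N
  proof (cases "N = 0")
    case True thus ?thesis using False assms by (simp add: field_simps)
  next
    case N: False
    obtain \<xi> where \<xi>: "real N < \<xi>" "\<xi> < real N + 1" "(real N + 1) powr y - real N powr y = y * \<xi> powr (y - 1)"
      using powr_diff_mean_value[of "real N" y] N by auto
    have "real (Suc N) powr (y - 1) \<le> \<xi> powr (y - 1)"
      using \<xi> N False by (intro powr_mono2') auto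
    also have "\<dots> = (real (Suc N) powr y - real N powr y) / y"
      using \<xi>(3) assms by (simp add: add_ac)
    finally show ?thesis by (simp only: diff_divide_distrib)
  qed
  have "(\<Sum>n<N. real (Suc n) powr (y - 1)) \<le> real N powr y / y"
  proof (induction N)
    case 0 show ?case by simp
  next
    case (Suc N)
    thus ?case using step[of N] by simp
  qed
  also have "\<dots> \<le> real (Suc N) powr y / y"
    using assms by (intro divide_right_mono powr_mono2) auto
  finally show ?thesis .
qed

lemma suminf_powr_tail_le:
  fixes x :: real
  assumes "x > 0"
  shows "summable (\<lambda>n. real (Suc (n + N)) powr (-1 - x))"
    and "(\<Sum>n. real (Suc (n + N)) powr (-1 - x)) \<le> real (Suc N) powr (-1 - x) + real (Suc N) powr (-x) / x"
proof -
  have partial: "(\<Sum>n<k. real (Suc (n + N)) powr (-1 - x))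
      \<le> real (Suc N) powr (-1 - x) + real (Suc N) powr (-x) / x" for k
  proof -
    have *: "(\<Sum>n<Suc k. real (Suc (n + N)) powr (-1 - x))
      \<le> real (Suc N) powr (-1 - x) + (real (Suc N) powr (-x) - real (Suc (k + N)) powr (-x)) / x" for k
    proof (induction k)
      case 0 show ?case by simp
    next
      case (Suc k)
      obtain \<xi> where \<xi>: "\<xi> < real (Suc (k+N)) + 1" "real (Suc (k+N)) < \<xi>"
        "(real (Suc (k+N)) + 1) powr (-x) - real (Suc (k+N)) powr (-x) = (-x) * \<xi> powr (-x - 1)"
        using powr_diff_mean_value[of "real (Suc (k+N))" "-x"] by auto
      have "real (Suc (Suc (k+N))) powr (-x - 1) \<le> \<xi> powr (-x - 1)"
        using \<xi>(1,2) assms by (intro powr_mono2') auto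
      hence "x * real (Suc (Suc (k+N))) powr (-x - 1) \<le> x * \<xi> powr (-x - 1)"
        using assms by (intro mult_left_mono) auto
      also have "\<dots> = real (Suc (k + N)) powr (-x) - real (Suc (Suc (k + N))) powr (-x)"
        using \<xi>(3) by (simp add: add_ac)
      finally have "real (Suc (Suc (k+N))) powr (-x - 1)
          \<le> (real (Suc (k + N)) powr (-x) - real (Suc (Suc (k + N))) powr (-x)) / x"
        using assms by (simp only: pos_le_divide_eq mult.commute[of _ x])
      moreover have "-x - 1 = -1 - x" by simp
      ultimately have step: "real (Suc (Suc k + N)) powr (-1 - x)
          \<le> (real (Suc (k + N)) powr (-x) - real (Suc (Suc k + N)) powr (-x)) / x"
        by (simp only: add_Suc)
      have "(\<Sum>n<Suc (Suc k). real (Suc (n + N)) powr (-1 - x))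
         = (\<Sum>n<Suc k. real (Suc (n + N)) powr (-1 - x)) + real (Suc (Suc k + N)) powr (-1 - x)"
        by (rule sum.lessThan_Suc)
      also note add_mono[OF Suc.IH step]
      finally show ?case by (simp only: diff_divide_distrib)
    qed
    have "(\<Sum>n<k. real (Suc (n + N)) powr (-1 - x)) \<le> (\<Sum>n<Suc k. real (Suc (n + N)) powr (-1 - x))"
      by simp
    also note *[of k]
    also have "real (Suc N) powr (-1 - x) + (real (Suc N) powr (-x) - real (Suc (k + N)) powr (-x)) / x
       \<le> real (Suc N) powr (-1 - x) + real (Suc N) powr (-x) / x"
      using assms by (intro add_left_mono divide_right_mono) auto
    finally show ?thesis .
  qed
  show s: "summable (\<lambda>n. real (Suc (n + N)) powr (-1 - x))"
    using partial[of "Suc _", unfolded lessThan_Suc_atMost]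
    by (rule bounded_imp_summable[rotated]) auto
  show "(\<Sum>n. real (Suc (n + N)) powr (-1 - x)) \<le> real (Suc N) powr (-1 - x) + real (Suc N) powr (-x) / x"
    using partial by (intro suminf_le_const s) auto
qed

lemma norm_of_nat_Suc_powr: "norm (of_nat (Suc n) powr z :: complex) = real (Suc n) powr Re z"
  using norm_powr_real_powr[of "of_nat (Suc n)" z] by (simp flip: of_nat_Suc)

text \<open>
  Convexity of the neighbourhood provides primitives, so that no contour has to be deformed
  explicitly.
\<close>

lemma compact_convex_imp_open_convex_nbhd:
  fixes K S :: "'a :: euclidean_space set"
  assumes "compact K" "convex K" "open S" "K \<subseteq> S"
  obtains U where "open U" "convex U" "K \<subseteq> U" "U \<subseteq> S"
proof -
  obtain e where e: "e > 0" "(\<Union>x\<in>K. ball x e) \<subseteq> S"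
    using compact_subset_open_imp_ball_epsilon_subset[OF assms(1,3,4)] .
  let ?U = "\<Union>x\<in>K. \<Union>y\<in>ball 0 e. {x + y}"
  have "open ?U" by (rule open_sums) auto
  moreover have "convex ?U" by (rule convex_sums) (use assms in auto)
  moreover have "K \<subseteq> ?U" using e(1) by force
  moreover have "?U \<subseteq> S"
  proof -
    have "?U \<subseteq> (\<Union>x\<in>K. ball x e)" by (auto simp: dist_norm)
    thus ?thesis using e(2) by blast
  qed
  ultimately show ?thesis using that by blast
qed

section \<open>The Tauberian theorem of Newman and Ingham\<close>

text \<open>
  This is the reason for Newman's factor \<open>1 + w\<^sup>2 / R\<^sup>2\<close>: it leaves the residue at \<open>0\<close> unchanged,
  but on the circle of radius \<open>R\<close> it makes the kernel proportional to \<open>Re w\<close>, which cancels the factor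
  \<open>1 / \<bar>Re w\<bar>\<close> in the estimates for the partial sums and the tails.
\<close>

lemma newman_kernel:
  assumes "norm w = R" "R > 0"
  shows "(1 + w\<^sup>2 / of_real (R\<^sup>2)) / w = of_real (2 * Re w / R\<^sup>2)"
proof -
  have w: "w \<noteq> 0" using assms by auto
  have R: "complex_of_real (R\<^sup>2) \<noteq> 0" using assms(2) by simp
  have c: "w * cnj w = of_real (R\<^sup>2)" using complex_norm_square[of w] assms(1) by metis
  have "1 / w = cnj w / of_real (R\<^sup>2)"
    unfolding frac_eq_eq[OF w R] mult_1 using c by (simp only: mult.commute[of w])
  moreover have "w\<^sup>2 / of_real (R\<^sup>2) / w = w / of_real (R\<^sup>2)"
    using w by (simp only: power2_eq_square) simp
  moreover have "(1 + w\<^sup>2 / of_real (R\<^sup>2)) / w = 1 / w + w\<^sup>2 / of_real (R\<^sup>2) / w"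
    by (rule add_divide_distrib)
  ultimately have "(1 + w\<^sup>2 / of_real (R\<^sup>2)) / w = (cnj w + w) / of_real (R\<^sup>2)"
    by (simp only: add_divide_distrib)
  also have "cnj w + w = of_real (2 * Re w)" using complex_add_cnj[of w] by (simp only: add.commute)
  finally show ?thesis by (simp only: of_real_divide)
qed

lemma convex_open_primitive:
  assumes "convex S" "open S" "f holomorphic_on S"
  shows "\<exists>F. \<forall>w\<in>S. (F has_field_derivative f w) (at w)"
proof (rule holomorphic_convex_primitive'[OF assms])
  fix F assume F: "\<And>w. w \<in> S \<Longrightarrow> (F has_field_derivative f w) (at w within S)"
  have "(F has_field_derivative f w) (at w)" if "w \<in> S" for w
    using F[OF that] unfolding at_within_open[OF that assms(2)] .
  thus ?thesis by (intro exI[of _ F] ballI)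
qed

text \<open>
  Cauchy's formula on the circle, kept as two half circles because the two halves are estimated
  differently. Subtracting the pole leaves an entire function, whose primitive contributes nothing
  to the closed curve; the pole itself is integrated explicitly.
\<close>

lemma contour_integral_half_circles_simple_pole:
  assumes hol: "g holomorphic_on UNIV" and R: "R > 0"
  shows "\<exists>I J. ((\<lambda>w. g w / w) has_contour_integral I) (part_circlepath 0 R (-pi/2) (pi/2)) \<and>
               ((\<lambda>w. g w / w) has_contour_integral J) (part_circlepath 0 R (pi/2) (3*pi/2)) \<and>
               I + J = 2 * of_real pi * \<i> * g 0"
proof -
  define q where "q = (\<lambda>w. if w = 0 then deriv g 0 else (g w - g 0) / (w - 0))"
  have qh: "q holomorphic_on UNIV" using pole_lemma_open[OF hol open_UNIV, of 0] by (simp only: q_def)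
  from convex_open_primitive[OF convex_UNIV open_UNIV qh]
  obtain Q where "\<forall>w\<in>UNIV. (Q has_field_derivative q w) (at w)" ..
  hence Q: "(Q has_field_derivative q w) (at w)" for w by simp
  have arc: "((\<lambda>w. g w / w) has_contour_integral
      (Q (pathfinish (part_circlepath 0 R s t)) - Q (pathstart (part_circlepath 0 R s t)) + g 0 * (\<i> * of_real (t - s))))
      (part_circlepath 0 R s t)" if "s < t" for s t
  proof -
    have A: "(q has_contour_integral
      (Q (pathfinish (part_circlepath 0 R s t)) - Q (pathstart (part_circlepath 0 R s t)))) (part_circlepath 0 R s t)"
      by (rule contour_integral_primitive[of UNIV]) (auto simp: Q)
    have "((\<lambda>w. 1 / w) has_contour_integral (\<i> * of_real (t - s))) (part_circlepath 0 R s t)"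
    proof -
      have "((\<lambda>x. \<i>) has_integral ((t - s) *\<^sub>R \<i>)) {s..t}"
        using has_integral_const_real[of \<i> s t] that by simp
      moreover have "(t - s) *\<^sub>R \<i> = \<i> * of_real (t - s)" by (simp add: scaleR_conv_of_real)
      ultimately show ?thesis using R that
        by (simp add: has_contour_integral_part_circlepath_iff)
    qed
    from has_contour_integral_add[OF A has_contour_integral_lmul[OF this, of "g 0"]]
    have "((\<lambda>w. q w + g 0 * (1 / w)) has_contour_integral
      (Q (pathfinish (part_circlepath 0 R s t)) - Q (pathstart (part_circlepath 0 R s t)) + g 0 * (\<i> * of_real (t - s))))
      (part_circlepath 0 R s t)" .
    thus ?thesis
    proof (rule has_contour_integral_eq)
      fix w assume "w \<in> path_image (part_circlepath 0 R s t)"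
      hence "norm w = R" using in_path_image_part_circlepath[of w 0 R s t] R that by simp
      hence "w \<noteq> 0" using R by auto
      thus "q w + g 0 * (1 / w) = g w / w" by (simp add: q_def field_simps)
    qed
  qed
  have ends: "pathfinish (part_circlepath 0 R (-pi/2) (pi/2)) = pathstart (part_circlepath 0 R (pi/2) (3*pi/2))"
       "pathstart (part_circlepath 0 R (-pi/2) (pi/2)) = pathfinish (part_circlepath 0 R (pi/2) (3*pi/2))"
  proof -
    have "exp (\<i> * of_real (-pi/2)) = exp (\<i> * of_real (3*pi/2))"
      by (subst exp_eq) (auto intro!: exI[of _ "-1"] simp: field_simps)
    thus "pathstart (part_circlepath 0 R (-pi/2) (pi/2)) = pathfinish (part_circlepath 0 R (pi/2) (3*pi/2))"
      by (simp only: pathstart_part_circlepath pathfinish_part_circlepath)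
  qed auto
  have angles: "pi/2 - (-pi/2) = pi" "3*pi/2 - pi/2 = pi" by simp_all
  have sum: "(x - y + c * (\<i> * of_real pi)) + (y - x + c * (\<i> * of_real pi)) = 2 * of_real pi * \<i> * c"
    for x y c :: complex by (simp add: algebra_simps)
  define x where "x = Q (pathfinish (part_circlepath 0 R (-pi/2) (pi/2)))"
  define y where "y = Q (pathstart (part_circlepath 0 R (-pi/2) (pi/2)))"
  have "- pi / 2 < pi / 2" "pi / 2 < 3 * pi / 2" by simp_all
  note arcs = this[THEN arc, unfolded angles]
  have "((\<lambda>w. g w / w) has_contour_integral (x - y + g 0 * (\<i> * of_real pi))) (part_circlepath 0 R (-pi/2) (pi/2))"
    using arcs(1) by (simp only: x_def y_def)
  moreover have "((\<lambda>w. g w / w) has_contour_integral (y - x + g 0 * (\<i> * of_real pi))) (part_circlepath 0 R (pi/2) (3*pi/2))"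
    using arcs(2) by (simp only: x_def y_def ends)
  ultimately show ?thesis using sum by blast
qed

lemma newman_tail_bound:
  fixes a :: "nat \<Rightarrow> complex"
  assumes bd: "\<And>n. norm (a n) \<le> C" and x: "Re w > 0"
    and series: "(\<lambda>n. a n * of_nat (Suc n) powr (-1 - w)) sums s"
  shows "norm (s - (\<Sum>n<N. a n * of_nat (Suc n) powr (-1 - w)))
    \<le> C * (real (Suc N) powr (-1 - Re w) + real (Suc N) powr (- Re w) / Re w)"
proof -
  have C: "C \<ge> 0" using bd[of 0] norm_ge_zero order_trans by blast
  let ?t = "\<lambda>n. a n * of_nat (Suc n) powr (-1 - w)"
  have "(\<lambda>n. ?t (n + N)) sums (s - (\<Sum>n<N. ?t n))"
    by (rule sums_split_initial_segment[OF series])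
  hence "s - (\<Sum>n<N. ?t n) = (\<Sum>n. ?t (n + N))" by (simp add: sums_iff)
  also have "norm \<dots> \<le> (\<Sum>n. C * real (Suc (n + N)) powr (-1 - Re w))"
  proof (rule norm_suminf_le)
    show "norm (?t (n + N)) \<le> C * real (Suc (n + N)) powr (-1 - Re w)" for n
      unfolding norm_mult norm_of_nat_Suc_powr using bd[of "n + N"] by (simp add: mult_right_mono)
    show "summable (\<lambda>n. C * real (Suc (n + N)) powr (-1 - Re w))"
      by (intro summable_mult suminf_powr_tail_le x)
  qed
  also have "\<dots> = C * (\<Sum>n. real (Suc (n + N)) powr (-1 - Re w))"
    by (intro suminf_mult suminf_powr_tail_le x)
  also have "\<dots> \<le> C * (real (Suc N) powr (-1 - Re w) + real (Suc N) powr (- Re w) / Re w)"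
    by (intro mult_left_mono suminf_powr_tail_le x C)
  finally show ?thesis .
qed

lemma newman_initial_bound:
  fixes a :: "nat \<Rightarrow> complex"
  assumes bd: "\<And>n. norm (a n) \<le> C" and x: "Re w < 0"
  shows "norm (\<Sum>n<N. a n * of_nat (Suc n) powr (-1 - w)) \<le> C * (real (Suc N) powr (- Re w) / (- Re w))"
proof -
  have C: "C \<ge> 0" using bd[of 0] norm_ge_zero order_trans by blast
  have "norm (\<Sum>n<N. a n * of_nat (Suc n) powr (-1 - w)) \<le> (\<Sum>n<N. C * real (Suc n) powr ((- Re w) - 1))"
  proof (rule sum_norm_le)
    fix n
    show "norm (a n * of_nat (Suc n) powr (-1 - w)) \<le> C * real (Suc n) powr ((- Re w) - 1)"
    proof -
      have "Re (-1 - w) = - Re w - 1" by simp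
      thus ?thesis
        unfolding norm_mult norm_of_nat_Suc_powr using bd[of n] by (simp only: mult_right_mono powr_ge_zero)
    qed
  qed
  also have "\<dots> = C * (\<Sum>n<N. real (Suc n) powr ((- Re w) - 1))" by (simp add: sum_distrib_left)
  also have "\<dots> \<le> C * (real (Suc N) powr (- Re w) / (- Re w))"
    by (intro mult_left_mono sum_powr_le C) (use x in auto)
  finally show ?thesis .
qed

text \<open>
  The contour argument, for \<open>f 0 = 0\<close>. Let \<open>F\<close> be the partial sum, \<open>M = Suc N\<close>, and
  integrate against \<open>M powr w * (1 + w\<^sup>2 / R\<^sup>2) / w\<close>. Cauchy's formula for the entire function \<open>F\<close>
  expresses \<open>F 0\<close> by integrals of \<open>F\<close> over the right and the left half circle. The left one is
  \<open>O(1 / R)\<close>. On the right one \<open>F\<close> is replaced by \<open>f\<close> with error \<open>O(1 / R)\<close>, and the integral of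
  \<open>f\<close> moves to the imaginary axis: \<open>f w / w\<close> is holomorphic near the closed right half disc because
  \<open>f 0 = 0\<close>. There \<open>M powr w\<close> oscillates, and integration by parts gains the factor
  \<open>1 / ln M\<close>.
\<close>

lemma newman_finite_estimate:
  fixes a :: "nat \<Rightarrow> complex" and f :: "complex \<Rightarrow> complex"
  assumes bd: "\<And>n. norm (a n) \<le> C" and S: "open S" and hS: "\<And>z. Re z \<ge> 0 \<Longrightarrow> z \<in> S"
    and hol: "f holomorphic_on S"
    and series: "\<And>z. Re z > 0 \<Longrightarrow> (\<lambda>n. a n * of_nat (Suc n) powr (-1 - z)) sums f z"
    and f0: "f 0 = 0" and R: "R > 0"
  shows "\<exists>B. \<forall>N\<ge>1. real (Suc N) \<ge> R \<longrightarrow>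
    2 * pi * norm (\<Sum>n<N. a n / of_nat (Suc n)) \<le> B / ln (real (Suc N)) + 6 * pi * C / R"
proof -
  have C: "C \<ge> 0" using bd[of 0] norm_ge_zero order_trans by blast
  define K where "K = cball 0 R \<inter> {w. 0 \<le> Re w}"
  have "compact K" unfolding K_def by (intro compact_Int_closed closed_halfspace_Re_ge) auto
  moreover have "convex K" unfolding K_def by (intro convex_Int convex_halfspace_Re_ge) auto
  moreover have "K \<subseteq> S" using hS by (auto simp: K_def)
  ultimately obtain U where U: "open U" "convex U" "K \<subseteq> U" "U \<subseteq> S"
    using S compact_convex_imp_open_convex_nbhd by metis
  define q where "q = (\<lambda>w. if w = 0 then deriv f 0 else (f w - f 0) / (w - 0))"
  have q: "q holomorphic_on U"
    unfolding q_def using hol U by (intro pole_lemma_open) (auto intro: holomorphic_on_subset)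
  define k where "k = (\<lambda>w. q w * (1 + w\<^sup>2 / of_real (R\<^sup>2)))"
  have k: "k holomorphic_on U"
    unfolding k_def using R by (intro holomorphic_intros q) auto
  have k': "deriv k holomorphic_on U" by (rule holomorphic_deriv[OF k U(1)])
  define p where "p = \<i> * of_real R"
  have p: "p \<in> K" "-p \<in> K" using R by (auto simp: K_def p_def norm_mult)
  define L where "L = closed_segment (-p) p"
  have LK: "L \<subseteq> K" unfolding L_def using p \<open>convex K\<close> by (simp add: closed_segment_subset)
  have LRe: "Re w = 0" if "w \<in> L" for w
    using that unfolding L_def p_def by (auto simp: in_segment)
  have bounded: "bounded (h ` L)" if "h holomorphic_on U" for h
  proof (intro compact_imp_bounded compact_continuous_image)
    show "continuous_on L h"
      using holomorphic_on_imp_continuous_on[OF that] LK U(3) by (meson continuous_on_subset order_trans)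
  qed (simp add: L_def)
  from bounded[OF k] bounded[OF k'] obtain B0 B1 where B0: "\<And>w. w \<in> L \<Longrightarrow> norm (k w) \<le> B0"
    and B1: "\<And>w. w \<in> L \<Longrightarrow> norm (deriv k w) \<le> B1"
    unfolding bounded_iff by (metis imageI)
  define B where "B = 2 * B0 + B1 * (2 * R)"
  have "2 * pi * norm (\<Sum>n<N. a n / of_nat (Suc n)) \<le> B / ln (real (Suc N)) + 6 * pi * C / R"
    if N: "N \<ge> 1" "real (Suc N) \<ge> R" for N
  proof -
    define M where "M = real (Suc N)"
    have M: "M > 1" "M \<ge> R" using N by (auto simp: M_def)
    define m where "m = ln M"
    have m: "m > 0" using M by (simp add: m_def)
    define E where "E = (\<lambda>w. complex_of_real M powr w)"
    have E': "(E has_field_derivative E w * of_real m) (at w)" for w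
      unfolding E_def m_def using M
      by (auto intro!: derivative_eq_intros simp: Ln_of_real)
    have Eh: "E holomorphic_on T" for T
      using E' by (meson holomorphic_onI field_differentiable_def field_differentiable_at_within)
    have nE: "norm (E w) = M powr Re w" for w
      unfolding E_def using M norm_powr_real_powr[of "of_real M" w] by simp
    have kE: "(\<lambda>w. k w * E w) holomorphic_on U" by (intro holomorphic_intros k Eh)
    from convex_open_primitive[OF U(2,1) kE]
    obtain P where "\<forall>w\<in>U. (P has_field_derivative k w * E w) (at w)" ..
    hence P': "(P has_field_derivative k w * E w) (at w)" if "w \<in> U" for w using that by simp
    hence P: "(P has_field_derivative k w * E w) (at w within U)" if "w \<in> U" for w
      using that has_field_derivative_at_within by blast
    \<comment> \<open>\<open>P p - P (-p)\<close> is the integral along the imaginary axis, where \<open>E\<close> has modulus \<open>1\<close>; \<open>G\<close> is what remains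
      after integration by parts, and its derivative carries the factor \<open>1 / m\<close>.\<close>
    have Pbound: "norm (P p - P (-p)) \<le> B / m"
    proof -
      define G where "G = (\<lambda>w. k w * E w / of_real m - P w)"
      have G': "(G has_field_derivative deriv k w * E w / of_real m) (at w within L)" if "w \<in> L" for w
      proof -
        have wU: "w \<in> U" using that LK U(3) by blast
        have "(G has_field_derivative (deriv k w * E w + E w * of_real m * k w) / of_real m - k w * E w) (at w)"
          unfolding G_def
          by (intro DERIV_diff DERIV_cdivide DERIV_mult holomorphic_derivI[OF k U(1) wU] E' P' wU)
        moreover have "(deriv k w * E w + E w * of_real m * k w) / of_real m - k w * E w = deriv k w * E w / of_real m"
          using m by (simp add: field_simps)
        ultimately show ?thesis by (simp add: has_field_derivative_at_within)
      qed
      have 0: "norm (deriv k w * E w / of_real m) \<le> B1 / m" if "w \<in> L" for w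
        using B1[OF that] LRe[OF that] M m by (simp add: norm_mult norm_divide nE divide_right_mono)
      have pL: "p \<in> L" "-p \<in> L" by (auto simp: L_def)
      have "norm (G p - G (-p)) \<le> B1 / m * norm (p - (-p))"
        by (rule field_differentiable_bound[OF _ G' 0 pL]) (simp_all add: L_def)
      moreover have "norm (p - (-p)) = 2 * R" using R by (simp add: p_def norm_mult)
      ultimately have 1: "norm (G p - G (-p)) \<le> B1 / m * (2 * R)" by simp
      have 2: "norm (k w * E w / of_real m) \<le> B0 / m" if "w \<in> L" for w
        using B0[OF that] LRe[OF that] M m by (simp add: norm_mult norm_divide nE divide_right_mono)
      have "P p - P (-p) = k p * E p / of_real m - k (-p) * E (-p) / of_real m - (G p - G (-p))"
        by (simp add: G_def)
      also have "norm \<dots> \<le> B0 / m + B0 / m + B1 / m * (2 * R)"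
        by (intro norm_triangle_le_diff add_mono 1 2 pL)
      also have "\<dots> = B / m" by (simp add: B_def add_divide_distrib)
      finally show ?thesis .
    qed
    define F where "F = (\<lambda>w. \<Sum>n<N. a n * of_nat (Suc n) powr (-1 - w))"
    define g where "g = (\<lambda>w. F w * E w * (1 + w\<^sup>2 / of_real (R\<^sup>2)))"
    have gh: "g holomorphic_on UNIV"
      unfolding g_def F_def using R by (intro holomorphic_intros Eh) (auto simp: complex_eq_iff)
    let ?A = "part_circlepath 0 R (-pi/2) (pi/2)" and ?A' = "part_circlepath 0 R (pi/2) (3*pi/2)"
    from contour_integral_half_circles_simple_pole[OF gh R]
    obtain I J where I: "((\<lambda>w. g w / w) has_contour_integral I) ?A"
      and J: "((\<lambda>w. g w / w) has_contour_integral J) ?A'" and IJ: "I + J = 2 * of_real pi * \<i> * g 0"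
      by (elim exE conjE) (rule that)
    have imA: "norm w = R" "Re w \<ge> 0" if "w \<in> path_image ?A" for w
      using that R by (auto simp: path_image_part_circlepath norm_mult Re_exp cos_ge_zero)
    have imA': "norm w = R" "Re w \<le> 0" if "w \<in> path_image ?A'" for w
    proof -
      have "pi/2 \<le> 3*pi/2" by simp
      from that[unfolded path_image_part_circlepath[OF this] mem_Collect_eq]
      obtain t where t': "w = 0 + of_real R * exp (\<i> * of_real t) \<and> pi/2 \<le> t \<and> t \<le> 3*pi/2" ..
      hence t: "w = of_real R * exp (\<i> * of_real t)" "pi/2 \<le> t" "t \<le> 3*pi/2" by simp_all
      have "cos (t - pi) \<ge> 0" using t by (intro cos_ge_zero) auto
      thus "norm w = R" "Re w \<le> 0" using R t(1) by (auto simp: norm_mult Re_exp mult_nonneg_nonpos)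
    qed
    have nz: "Re w \<noteq> 0" if "norm w = R" "w \<notin> {p, -p}" for w
    proof
      assume 0: "Re w = 0"
      hence "\<bar>Im w\<bar> = R" using that(1) by (simp add: norm_complex_def)
      hence "w = p \<or> w = -p" using 0 by (auto simp: p_def complex_eq_iff abs_if split: if_splits)
      thus False using that(2) by simp
    qed
    have "((\<lambda>w. k w * E w) has_contour_integral (P (pathfinish ?A) - P (pathstart ?A))) ?A"
      by (rule contour_integral_primitive[OF P]) (use imA U(3) in \<open>auto simp: K_def\<close>)
    moreover have "pathfinish ?A = p" "pathstart ?A = -p"
      using cis_pi_half cis_minus_pi_half by (auto simp: p_def cis_conv_exp)
    ultimately have "((\<lambda>w. k w * E w) has_contour_integral (P p - P (-p))) ?A" by simp
    from has_contour_integral_diff[OF this I]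
    have "((\<lambda>w. k w * E w - g w / w) has_contour_integral (P p - P (-p) - I)) ?A" .
    hence "norm (P p - P (-p) - I) \<le> (4 * C / R\<^sup>2) * R * (pi/2 - (-pi/2))"
    proof (rule has_contour_integral_bound_part_circlepath_strong[where k = "{p, -p}"])
      fix w assume w: "w \<in> path_image ?A - {p, -p}"
      have nw: "norm w = R" and x: "Re w > 0"
        using imA[of w] nz[of w] w by auto
      have xR: "Re w \<le> R" using nw complex_Re_le_cmod[of w] by simp
      have w0: "w \<noteq> 0" using x by auto
      have "k w * E w - g w / w = (f w - F w) * E w * ((1 + w\<^sup>2 / of_real (R\<^sup>2)) / w)"
        using w0 f0 by (simp add: k_def g_def q_def diff_divide_distrib algebra_simps add_divide_distrib)
      also have "\<dots> = (f w - F w) * E w * of_real (2 * Re w / R\<^sup>2)"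
        by (simp only: newman_kernel[OF nw R])
      also have "norm \<dots> = norm (f w - F w) * M powr Re w * (2 * Re w / R\<^sup>2)"
        using x by (simp only: norm_mult nE norm_of_real) simp
      also have "\<dots> \<le> (C * (M powr (-1 - Re w) + M powr (- Re w) / Re w)) * M powr Re w * (2 * Re w / R\<^sup>2)"
        unfolding M_def F_def
        by (intro mult_right_mono newman_tail_bound bd series x) (use x in auto)
      also have "\<dots> = C * (Re w / M + 1) * (2 / R\<^sup>2)"
      proof -
        have "M powr (-1 - Re w) = 1 / (M * M powr Re w)" "M powr (- Re w) = 1 / M powr Re w"
          using M powr_add[of M 1 "Re w"] powr_minus_divide[of M "1 + Re w"] by (auto simp: powr_minus_divide)
        moreover have "M powr Re w > 0" using M by simp
        ultimately show ?thesis using x M R by (simp add: field_simps)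
      qed
      also have "\<dots> \<le> C * (1 + 1) * (2 / R\<^sup>2)"
        using xR M C R x by (intro mult_right_mono mult_left_mono add_right_mono) (auto simp: field_simps)
      finally show "norm (k w * E w - g w / w) \<le> 4 * C / R\<^sup>2" by simp
    qed (use C R in auto)
    also have "\<dots> = 4 * pi * C / R" using R by (simp add: power2_eq_square)
    finally have 1: "norm (P p - P (-p) - I) \<le> 4 * pi * C / R" .
    from J have "norm J \<le> (2 * C / R\<^sup>2) * R * (3*pi/2 - pi/2)"
    proof (rule has_contour_integral_bound_part_circlepath_strong[where k = "{p, -p}"])
      fix w assume w: "w \<in> path_image ?A' - {p, -p}"
      have nw: "norm w = R" and x: "Re w < 0"
        using imA'[of w] nz[of w] w by auto
      have "g w / w = F w * E w * ((1 + w\<^sup>2 / of_real (R\<^sup>2)) / w)"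
        by (simp add: g_def)
      also have "\<dots> = F w * E w * of_real (2 * Re w / R\<^sup>2)"
        by (simp only: newman_kernel[OF nw R])
      also have "norm \<dots> = norm (F w) * M powr Re w * (2 * (- Re w) / R\<^sup>2)"
        proof -
        have "2 * Re w / R\<^sup>2 \<le> 0" using x by (intro divide_nonpos_nonneg) auto
        hence "\<bar>2 * Re w / R\<^sup>2\<bar> = 2 * (- Re w) / R\<^sup>2" by (simp only: abs_of_nonpos)
        thus ?thesis by (simp only: norm_mult nE norm_of_real)
      qed
      also have "\<dots> \<le> (C * (M powr (- Re w) / (- Re w))) * M powr Re w * (2 * (- Re w) / R\<^sup>2)"
        unfolding M_def F_def
        by (intro mult_right_mono newman_initial_bound bd x) (use x in \<open>auto intro!: divide_nonpos_nonneg\<close>)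
      also have "\<dots> = 2 * C / R\<^sup>2"
      proof -
        have "M powr (- Re w) * M powr Re w = 1" using M by (simp flip: powr_add)
        hence "C * (M powr (- Re w) * M powr Re w) * 2 / R\<^sup>2 = 2 * C / R\<^sup>2" by simp
        thus ?thesis using x by (simp add: field_simps)
      qed
      finally show "norm (g w / w) \<le> 2 * C / R\<^sup>2" .
    qed (use C R in auto)
    also have "\<dots> = 2 * pi * C / R" using R by (simp add: power2_eq_square)
    finally have 2: "norm J \<le> 2 * pi * C / R" .
    have "F 0 = (\<Sum>n<N. a n / of_nat (Suc n))"
      unfolding F_def by (intro sum.cong) (auto simp: powr_minus_divide simp del: of_nat_Suc)
    moreover have "g 0 = F 0" using M by (simp add: g_def E_def)
    ultimately have "2 * pi * norm (\<Sum>n<N. a n / of_nat (Suc n)) = norm (I + J)"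
      by (simp add: IJ norm_mult)
    also have "I + J = (P p - P (-p)) - (P p - P (-p) - I) + J" by simp
    also have "norm \<dots> \<le> B / m + 4 * pi * C / R + 2 * pi * C / R"
      by (rule norm_triangle_le, rule add_mono[OF _ 2], rule norm_triangle_le_diff, rule add_mono[OF Pbound 1])
    also have "\<dots> = B / m + (4 * pi * C + 2 * pi * C) / R" by (simp only: add_divide_distrib add.assoc)
    also have "4 * pi * C + 2 * pi * C = 6 * pi * C" by simp
    also have "B / m = B / ln (real (Suc N))" by (simp only: m_def M_def)
    finally show ?thesis .
  qed
  thus ?thesis by blast
qed

text \<open>
  Changing the coefficient at \<open>n = 0\<close> shifts the sum of the series by a constant, which reduces the
  theorem to \<open>f 0 = 0\<close>. In \<open>newman_finite_estimate\<close> a large \<open>R\<close> is chosen first, and then \<open>N\<close>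
  tends to infinity.
\<close>

theorem newman_ingham:
  fixes a :: "nat \<Rightarrow> complex" and f :: "complex \<Rightarrow> complex"
  assumes bd: "\<And>n. norm (a n) \<le> C" and S: "open S" and hS: "\<And>z. Re z \<ge> 0 \<Longrightarrow> z \<in> S"
    and hol: "f holomorphic_on S"
    and series: "\<And>z. Re z > 0 \<Longrightarrow> (\<lambda>n. a n * of_nat (Suc n) powr (-1 - z)) sums f z"
  shows "(\<lambda>n. a n / of_nat (Suc n)) sums f 0"
proof -
  define b where "b = (\<lambda>n. a n - (if n = 0 then f 0 else 0))"
  define h where "h = (\<lambda>z. f z - f 0)"
  define D where "D = C + norm (f 0)"
  have bdb: "norm (b n) \<le> D" for n
    using bd[of n] norm_triangle_ineq4[of "a n" "f 0"] norm_ge_zero[of "f 0"] unfolding b_def D_def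
    by (cases "n = 0") (simp_all del: norm_ge_zero)
  have D: "D \<ge> 0" using bdb[of 0] norm_ge_zero order_trans by blast
  have serb: "(\<lambda>n. b n * of_nat (Suc n) powr (-1 - z)) sums h z" if "Re z > 0" for z
  proof -
    have "(\<lambda>n. if n = 0 then f 0 else 0) sums (f 0)" using sums_single[of 0 "\<lambda>_. f 0"] by simp
    from sums_diff[OF series[OF that] this]
    have "(\<lambda>n. a n * of_nat (Suc n) powr (-1 - z) - (if n = 0 then f 0 else 0)) sums h z"
      by (simp only: h_def)
    moreover have "a n * of_nat (Suc n) powr (-1 - z) - (if n = 0 then f 0 else 0)
        = b n * of_nat (Suc n) powr (-1 - z)" for n
      by (cases "n = 0") (auto simp: b_def)
    ultimately show ?thesis by (simp only:)
  qed
  have holh: "h holomorphic_on S" unfolding h_def by (intro holomorphic_intros hol)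
  have lim: "(\<lambda>N. \<Sum>n<N. b n / of_nat (Suc n)) \<longlonglongrightarrow> 0"
  proof (rule tendstoI)
    fix e :: real assume e: "e > 0"
    \<comment> \<open>Makes the term \<open>6 * pi * D / R\<close> of the estimate smaller than \<open>pi * e\<close>.\<close>
    define R where "R = 6 * D / e + 1"
    have R: "R > 0" using D e by (simp add: R_def add_nonneg_pos)
    have "6 * D < e * R" using e D by (simp add: R_def field_simps)
    hence Re: "6 * pi * D / R < pi * e" using R by (simp add: field_simps)
    obtain B where B: "\<And>N. N \<ge> 1 \<Longrightarrow> real (Suc N) \<ge> R \<Longrightarrow>
      2 * pi * norm (\<Sum>n<N. b n / of_nat (Suc n)) \<le> B / ln (real (Suc N)) + 6 * pi * D / R"
      using newman_finite_estimate[OF bdb S hS holh serb _ R] by (auto simp: h_def)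
    have "((\<lambda>N. B / ln (real (Suc N))) \<longlongrightarrow> 0) at_top" by real_asymp
    hence "\<forall>\<^sub>F N in sequentially. B / ln (real (Suc N)) < pi * e"
      using e by (intro order_tendstoD(2)) auto
    moreover have "\<forall>\<^sub>F N in sequentially. R \<le> real (Suc N)" by real_asymp
    ultimately show "\<forall>\<^sub>F N in sequentially. dist (\<Sum>n<N. b n / of_nat (Suc n)) 0 < e"
      using eventually_ge_at_top[of 1]
    proof eventually_elim
      case (elim N)
      have "2 * pi * norm (\<Sum>n<N. b n / of_nat (Suc n)) < pi * e + pi * e"
        using B[OF elim(3,2)] elim(1) Re by linarith
      thus ?case by (simp add: field_simps)
    qed
  qed
  hence "(\<lambda>n. b n / of_nat (Suc n)) sums 0" by (simp only: sums_def)
  moreover have "(\<lambda>n. if n = 0 then f 0 else 0) sums (f 0)" using sums_single[of 0 "\<lambda>_. f 0"] by simp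
  ultimately have "(\<lambda>n. b n / of_nat (Suc n) + (if n = 0 then f 0 else 0)) sums (0 + f 0)"
    by (rule sums_add)
  moreover have "b n / of_nat (Suc n) + (if n = 0 then f 0 else 0) = a n / of_nat (Suc n)" for n
    by (cases "n = 0") (simp_all add: b_def)
  ultimately show ?thesis by (simp only: add_0)
qed

section \<open>Analytic continuation of the zeta function\<close>

text \<open>
  Absolute convergence allows the double series over \<open>(i, j)\<close> to be rearranged according to the
  product \<open>Suc i * Suc j = Suc n\<close>.
\<close>

lemma dirichlet_product_sums:
  fixes f g :: "nat \<Rightarrow> complex"
  assumes f: "summable (\<lambda>n. norm (f (Suc n)))" and g: "summable (\<lambda>n. norm (g (Suc n)))"
  shows "(\<lambda>n. \<Sum>d | d dvd Suc n. f d * g (Suc n div d)) sums ((\<Sum>n. f (Suc n)) * (\<Sum>n. g (Suc n)))"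
proof -
  let ?F = "\<Sum>n. f (Suc n)" and ?G = "\<Sum>n. g (Suc n)"
  have sf: "((\<lambda>n. f (Suc n)) has_sum ?F) UNIV" and sg: "((\<lambda>n. g (Suc n)) has_sum ?G) UNIV"
    by (rule norm_summable_imp_has_sum, fact, rule summable_sums, rule summable_norm_cancel, fact)+
  have nf: "((\<lambda>n. norm (f (Suc n)))) summable_on UNIV" and ng: "((\<lambda>n. norm (g (Suc n)))) summable_on UNIV"
    using f g by (auto intro!: norm_summable_imp_summable_on)
  have "(\<lambda>p. norm ((\<lambda>(i,j). f (Suc i) * g (Suc j)) p)) summable_on (UNIV \<times> UNIV)"
    unfolding Infinite_Sum.abs_summable_on_Sigma_iff
    using nf ng
    by (auto simp: norm_mult abs_mult infsum_cmult_right' intro!: summable_on_cmult_right summable_on_cmult_left)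
  from Infinite_Sum.abs_summable_summable[OF this]
  have summ: "(\<lambda>(i,j). f (Suc i) * g (Suc j)) summable_on (UNIV \<times> UNIV)" .
  have "((\<lambda>(i,j). f (Suc i) * g (Suc j)) has_sum (?F * ?G)) (UNIV \<times> UNIV)"
  proof (rule has_sum_SigmaI[OF _ _ summ])
    show "((\<lambda>j. case (i, j) of (i, j) \<Rightarrow> f (Suc i) * g (Suc j)) has_sum f (Suc i) * ?G) UNIV" for i
      using has_sum_cmult_right[OF sg] by simp
    show "((\<lambda>i. f (Suc i) * ?G) has_sum (?F * ?G)) UNIV"
      by (rule has_sum_cmult_left[OF sf])
  qed
  also have "?this \<longleftrightarrow> ((\<lambda>(n,d). f d * g (Suc n div d)) has_sum (?F * ?G)) (Sigma UNIV (\<lambda>n. {d. d dvd Suc n}))"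
  proof (rule has_sum_reindex_bij_witness[where i = "\<lambda>(n,d). (d - 1, Suc n div d - 1)"
        and j = "\<lambda>(i,j). (Suc i * Suc j - 1, Suc i)"])
    fix b assume "b \<in> Sigma UNIV (\<lambda>n. {d. d dvd Suc n})"
    then obtain n d where "b = (n, d)" and "d dvd Suc n" by auto
    then obtain k where e: "Suc n = d * k" by (elim dvdE)
    hence "d > 0" "k > 0" by (auto intro!: Nat.gr0I)
    with e \<open>b = (n, d)\<close> show "(case case b of (n, d) \<Rightarrow> (d - 1, Suc n div d - 1) of (i, j) \<Rightarrow> (Suc i * Suc j - 1, Suc i)) = b"
      by (simp del: mult_Suc mult_Suc_right)
  next
    fix a :: "nat \<times> nat"
    obtain i j where a: "a = (i, j)" by fastforce
    have 1: "Suc (Suc i * Suc j - 1) = Suc i * Suc j" by simp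
    have 2: "Suc i * Suc j div Suc i = Suc j" by (rule nonzero_mult_div_cancel_left) simp
    show "(case case a of (i, j) \<Rightarrow> (Suc i * Suc j - 1, Suc i) of (n, d) \<Rightarrow> (d - 1, Suc n div d - 1)) = a"
      by (simp only: a prod.case 1 2 diff_Suc_1)
    show "(case a of (i, j) \<Rightarrow> (Suc i * Suc j - 1, Suc i)) \<in> Sigma UNIV (\<lambda>n. {d. d dvd Suc n})"
      by (simp only: a prod.case mem_Sigma_iff mem_Collect_eq 1 dvd_triv_left UNIV_I)
    show "(case case a of (i, j) \<Rightarrow> (Suc i * Suc j - 1, Suc i) of (n, d) \<Rightarrow> f d * g (Suc n div d))
          = (case a of (i, j) \<Rightarrow> f (Suc i) * g (Suc j))"
      by (simp only: a prod.case 1 2)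
  qed auto
  finally have "((\<lambda>n. \<Sum>d | d dvd Suc n. f d * g (Suc n div d)) has_sum (?F * ?G)) UNIV"
    by (rule has_sum_SigmaD) (auto intro!: has_sum_finiteI)
  thus ?thesis by (rule has_sum_imp_sums)
qed

text \<open>
  Up to the factor \<open>s - 1\<close> this is \<open>m powr (-s)\<close> minus the integral of \<open>t powr (-s)\<close> over
  \<open>[m, m + 1]\<close>, for \<open>m = Suc n\<close>. Multiplying by \<open>s - 1\<close> makes the terms entire, so the pole of
  \<open>\<zeta>\<close> never needs separate treatment.
\<close>

definition zeta_term :: "nat \<Rightarrow> complex \<Rightarrow> complex" where
  "zeta_term n s = (s - 1) * of_nat (Suc n) powr (-s)
     + of_nat (Suc (Suc n)) powr (1 - s) - of_nat (Suc n) powr (1 - s)"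

lemma holomorphic_zeta_term [holomorphic_intros]: "zeta_term n holomorphic_on A"
  unfolding zeta_term_def by (intro holomorphic_intros)

text \<open>
  The term is a second-order Taylor remainder of \<open>x \<mapsto> x powr (1 - s)\<close>; this gains one power of
  \<open>n\<close> over the terms of the zeta series.
\<close>

lemma norm_zeta_term_le:
  assumes "Re s > 0"
  shows "norm (zeta_term n s) \<le> norm (s - 1) * norm s * real (Suc n) powr (-1 - Re s)"
proof -
  define m where "m = real (Suc n)"
  have m: "m > 0" by (simp add: m_def)
  define S where "S = closed_segment (complex_of_real m) (of_real (m + 1))"
  have S: "\<exists>t\<ge>m. x = of_real t" if "x \<in> S" for x
  proof -
    from that obtain u where u: "0 \<le> u" "u \<le> 1" "x = (1 - u) *\<^sub>R of_real m + u *\<^sub>R of_real (m + 1)"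
      unfolding S_def in_segment by blast
    hence "x = of_real (m + u)" by (simp add: scaleR_conv_of_real algebra_simps)
    thus ?thesis using u(1) by (intro exI[of _ "m + u"]) simp
  qed
  have S0: "x \<notin> \<real>\<^sub>\<le>\<^sub>0" "x \<noteq> 0" if "x \<in> S" for x
    using S[OF that] m by auto
  \<comment> \<open>The function \<open>x powr (1 - s)\<close> and its first two derivatives.\<close>
  define u where "u = (\<lambda>i x. if i = (0::nat) then x powr (1 - s) else if i = 1 then (1 - s) * x powr (-s)
       else (1 - s) * (-s) * x powr (-s - 1))"
  have "norm (u 0 (of_real (m + 1)) - (\<Sum>i\<le>1. u i (of_real m) * (of_real (m + 1) - of_real m) ^ i / fact i))
       \<le> (norm (s - 1) * norm s * m powr (-1 - Re s)) * norm (complex_of_real (m + 1) - of_real m) ^ Suc 1 / fact 1"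
  proof (rule complex_Taylor[where S = S])
    show "convex S" by (simp add: S_def)
    show "(u i has_field_derivative u (Suc i) x) (at x within S)" if "x \<in> S" "i \<le> 1" for i x
    proof (cases "i = 0")
      case True
      have "((\<lambda>x. x powr (1 - s)) has_field_derivative (1 - s) * x powr (1 - s - 1)) (at x within S)"
        using S0[OF that(1)] by (intro has_field_derivative_powr has_field_derivative_at_within)
      thus ?thesis using True by (simp add: u_def)
    next
      case False
      hence i: "i = 1" using that by simp
      have "((\<lambda>x. (1 - s) * x powr (-s)) has_field_derivative (1 - s) * ((-s) * x powr (-s - 1))) (at x within S)"
        using S0[OF that(1)] by (intro DERIV_cmult has_field_derivative_powr has_field_derivative_at_within)
      thus ?thesis by (simp add: u_def i mult.assoc)
    qed
    show "norm (u (Suc 1) x) \<le> norm (s - 1) * norm s * m powr (-1 - Re s)" if x: "x \<in> S" for x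
    proof -
      obtain t where t: "t \<ge> m" "x = of_real t" using S[OF x] by blast
      have swap: "-s - 1 = -1 - s" by simp
      have "norm (x powr (-s - 1)) = t powr (-1 - Re s)"
        using t m norm_powr_real_powr[of "of_real t" "-1 - s"] by (simp add: swap)
      also have "\<dots> \<le> m powr (-1 - Re s)" using t m assms by (intro powr_mono2') auto
      finally show ?thesis
        by (simp add: u_def norm_mult mult_left_mono norm_minus_commute)
    qed
  qed (auto simp: S_def)
  moreover have "u 0 (of_real (m + 1)) - (\<Sum>i\<le>1. u i (of_real m) * (of_real (m + 1) - of_real m) ^ i / fact i) = zeta_term n s"
    by (simp add: u_def zeta_term_def m_def algebra_simps)
  ultimately show ?thesis by (simp add: m_def)
qed

lemma summable_Suc_powr: "x > 1 \<Longrightarrow> summable (\<lambda>n. real (Suc n) powr (-x))"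
  using suminf_powr_tail_le(1)[of "x - 1" 0] by simp

text \<open>
  Constant coefficients (\<open>e = 0\<close>) give the continuation of \<open>\<zeta>\<close>; coefficients of linear growth
  (\<open>e = 1\<close>) occur with \<open>b n = \<psi> (Suc n) - Suc n\<close>.
\<close>

lemma holomorphic_zeta_term_series:
  fixes b :: "nat \<Rightarrow> complex"
  assumes b: "\<And>n. norm (b n) \<le> C * real (Suc n) powr e" and e: "e \<ge> 0"
  shows "(\<lambda>s. \<Sum>n. b n * zeta_term n s) holomorphic_on {s. Re s > e}"
    and "Re s > e \<Longrightarrow> summable (\<lambda>n. b n * zeta_term n s)"
proof -
  have C: "C \<ge> 0" using order_trans[OF norm_ge_zero b[of 0]] by simp
  have bound: "norm (b n * zeta_term n s) \<le> C * (K * K) * real (Suc n) powr (-(1 + r - e))"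
    if "Re s \<ge> r" "r > 0" "norm s + 1 \<le> K" for n s r K
  proof -
    have "norm (b n * zeta_term n s) \<le> (C * real (Suc n) powr e) * (norm (s - 1) * norm s * real (Suc n) powr (-1 - Re s))"
      unfolding norm_mult[of "b n"] using C by (intro mult_mono b norm_zeta_term_le) (use that in auto)
    also have "\<dots> \<le> (C * real (Suc n) powr e) * (K * K * real (Suc n) powr (-1 - r))"
    proof (intro mult_left_mono mult_mono)
      show "norm (s - 1) \<le> K" using that norm_triangle_ineq4[of s 1] by simp
      show "norm s \<le> K" using that by simp
      show "0 \<le> K" using that norm_ge_zero[of s] by linarith
      show "real (Suc n) powr (-1 - Re s) \<le> real (Suc n) powr (-1 - r)" using that by (intro powr_mono) auto
    qed (use C in auto)
    also have "\<dots> = C * (K * K) * (real (Suc n) powr e * real (Suc n) powr (-1 - r))" by (simp only: mult_ac)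
    also have "real (Suc n) powr e * real (Suc n) powr (-1 - r) = real (Suc n) powr (-(1 + r - e))"
      by (simp only: powr_add[symmetric]) (simp add: algebra_simps)
    finally show ?thesis .
  qed
  show "(\<lambda>s. \<Sum>n. b n * zeta_term n s) holomorphic_on {s. Re s > e}"
  proof (rule series_and_derivative_locally_dominated(1))
    show "open {s. Re s > e}" by (rule open_halfspace_Re_gt)
    show "(\<lambda>s. b n * zeta_term n s) holomorphic_on {s. Re s > e}" for n by (intro holomorphic_intros)
    fix x assume x: "x \<in> {s. Re s > e}"
    define d where "d = (Re x - e) / 2"
    have d: "d > 0" using x by (simp add: d_def)
    define h where "h = (\<lambda>n. C * ((norm x + d + 1) * (norm x + d + 1)) * real (Suc n) powr (-(1 + (e + d) - e)))"
    have "summable h" unfolding h_def using d by (intro summable_mult summable_Suc_powr) simp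
    moreover have "norm (b n * zeta_term n y) \<le> h n" if y: "y \<in> ball x d \<inter> {s. Re s > e}" for n y
      unfolding h_def
    proof (rule bound)
      have n: "norm (x - y) < d" using y by (simp add: dist_norm)
      have "Re x - Re y \<le> norm (x - y)" using complex_Re_le_cmod[of "x - y"] by simp
      thus "e + d \<le> Re y" using n by (simp add: d_def field_simps)
      show "e + d > 0" using e d by simp
      have "norm y \<le> norm x + norm (x - y)" using norm_triangle_ineq4[of x "x - y"] by simp
      thus "norm y + 1 \<le> norm x + d + 1" using n by simp
    qed
    ultimately show "\<exists>d>0. \<exists>h. summable h \<and> (\<forall>n. \<forall>y\<in>ball x d \<inter> {s. Re s > e}. norm (b n * zeta_term n y) \<le> h n)"
      using d by (intro exI[of _ d] exI[of _ h] conjI allI ballI)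
  qed
  show "summable (\<lambda>n. b n * zeta_term n s)" if "Re s > e"
  proof (rule summable_comparison_test'[where N = 0])
    show "summable (\<lambda>n. C * ((norm s + 1) * (norm s + 1)) * real (Suc n) powr (-(1 + Re s - e)))"
      using that by (intro summable_mult summable_Suc_powr) simp
    show "norm (b n * zeta_term n s) \<le> C * ((norm s + 1) * (norm s + 1)) * real (Suc n) powr (-(1 + Re s - e))" for n
      by (rule bound) (use that e in auto)
  qed
qed

text \<open>
  The analytic continuation of \<open>(s - 1) \<zeta>(s)\<close> to the half plane \<open>Re s > 0\<close>.
\<close>

definition zeta_reg :: "complex \<Rightarrow> complex" where
  "zeta_reg s = 1 + (\<Sum>n. zeta_term n s)"

abbreviation zeta_series :: "complex \<Rightarrow> complex" where
  "zeta_series s \<equiv> (\<Sum>n. of_nat (Suc n) powr (-s))"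

abbreviation mangoldt_series :: "complex \<Rightarrow> complex" where
  "mangoldt_series s \<equiv> (\<Sum>n. mangoldt (Suc n) * of_nat (Suc n) powr (-s))"

lemma holomorphic_zeta_reg: "zeta_reg holomorphic_on {s. Re s > 0}"
proof -
  have "(\<lambda>s. \<Sum>n. 1 * zeta_term n s) holomorphic_on {s. Re s > 0}"
    by (rule holomorphic_zeta_term_series(1)[where C = 1]) auto
  hence "(\<lambda>s. 1 + (\<Sum>n. 1 * zeta_term n s)) holomorphic_on {s. Re s > 0}"
    by (intro holomorphic_intros)
  thus ?thesis by (simp only: zeta_reg_def[abs_def] mult_1)
qed

lemma zeta_reg_1 [simp]: "zeta_reg 1 = 1"
  by (simp add: zeta_reg_def zeta_term_def del: of_nat_Suc)

lemma summable_norm_zeta_series: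
  assumes "Re s > 1"
  shows "summable (\<lambda>n. norm (of_nat (Suc n) powr (-s) :: complex))"
  unfolding norm_of_nat_Suc_powr using summable_Suc_powr[OF assms] by simp

text \<open>
  The terms \<open>m powr (1 - s)\<close> telescope to \<open>-1\<close>, which the summand \<open>1\<close> in the definition of
  \<open>zeta_reg\<close> compensates.
\<close>

lemma zeta_reg_eq:
  assumes s: "Re s > 1"
  shows "zeta_reg s = (s - 1) * zeta_series s"
proof -
  let ?p = "\<lambda>n. complex_of_nat (Suc n) powr (1 - s)"
  have "(\<lambda>n. real (Suc n) powr (1 - Re s)) \<longlonglongrightarrow> 0" using s by real_asymp
  hence "(\<lambda>n. norm (?p n)) \<longlonglongrightarrow> 0"
    unfolding norm_of_nat_Suc_powr minus_complex.simps one_complex.simps .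
  hence "?p \<longlonglongrightarrow> 0" by (rule tendsto_norm_zero_cancel)
  note telescope = telescope_sums[OF this]
  note zeta = sums_mult[OF summable_sums[OF summable_norm_cancel[OF summable_norm_zeta_series[OF s]]], of "s - 1"]
  have "(\<lambda>n. zeta_term n s) sums ((s - 1) * zeta_series s + (0 - ?p 0))"
    unfolding zeta_term_def add_diff_eq[symmetric] by (rule sums_add[OF zeta telescope])
  moreover have "?p 0 = 1" by simp
  ultimately have "(\<lambda>n. zeta_term n s) sums ((s - 1) * zeta_series s - 1)" by simp
  hence "(\<Sum>n. zeta_term n s) = (s - 1) * zeta_series s - 1" by (simp only: sums_iff)
  thus ?thesis by (simp add: zeta_reg_def)
qed

lemma zeta_series_derivative:
  assumes s: "Re s > 1"
  shows "(zeta_series has_field_derivative deriv zeta_series s) (at s)"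
    and "(\<lambda>n. - (of_real (ln (real (Suc n))) * of_nat (Suc n) powr (-s))) sums deriv zeta_series s"
proof -
  have op: "open {s. Re s > 1}" by (rule open_halfspace_Re_gt)
  have hol: "(\<lambda>s. of_nat (Suc n) powr (-s)) holomorphic_on {s. Re s > 1}" for n
    by (intro holomorphic_intros)
  have dom: "\<exists>d>0. \<exists>h. summable h \<and> (\<forall>n. \<forall>y\<in>ball x d \<inter> {s. Re s > 1}. norm (of_nat (Suc n) powr (-y) :: complex) \<le> h n)"
    if "x \<in> {s. Re s > 1}" for x
  proof -
    define d where "d = (Re x - 1) / 2"
    have d: "d > 0" using that by (simp add: d_def)
    have "norm (of_nat (Suc n) powr (-y) :: complex) \<le> real (Suc n) powr (-(1 + d))" if "y \<in> ball x d" for y n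
    proof -
      have "Re x - Re y \<le> norm (x - y)" using complex_Re_le_cmod[of "x - y"] by simp
      hence "1 + d \<le> Re y" using that by (simp add: d_def dist_norm field_simps)
      thus ?thesis unfolding norm_of_nat_Suc_powr by (intro powr_mono) auto
    qed
    moreover have "summable (\<lambda>n. real (Suc n) powr (-(1 + d)))" using d by (intro summable_Suc_powr) simp
    ultimately show ?thesis using d
      by (intro exI[of _ d] exI[of _ "\<lambda>n. real (Suc n) powr (-(1 + d))"] conjI allI ballI) auto
  qed
  note D = series_and_derivative_locally_dominated[OF op hol dom]
  show "(zeta_series has_field_derivative deriv zeta_series s) (at s)"
    by (rule holomorphic_derivI[OF D(1) op]) (use s in auto)
  have "deriv (\<lambda>s. of_nat (Suc n) powr (-s)) s = - (of_real (ln (real (Suc n))) * of_nat (Suc n) powr (-s))" for n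
  proof (rule DERIV_imp_deriv)
    have "Ln (of_nat (Suc n)) = of_real (ln (real (Suc n)))"
      using Ln_of_real[of "real (Suc n)"] by (simp del: of_nat_Suc)
    moreover have "((\<lambda>s. of_nat (Suc n) powr (-s)) has_field_derivative
        (Ln (of_nat (Suc n)) * of_nat (Suc n) powr (-s)) * (-1)) (at s)"
      by (rule DERIV_chain2[OF has_field_derivative_powr_right]) (auto intro!: derivative_eq_intros simp del: of_nat_Suc)
    ultimately show "((\<lambda>s. of_nat (Suc n) powr (-s)) has_field_derivative
        - (of_real (ln (real (Suc n))) * of_nat (Suc n) powr (-s))) (at s)"
      by (simp only: mult_minus1_right)
  qed
  with D(2)[of s] s show "(\<lambda>n. - (of_real (ln (real (Suc n))) * of_nat (Suc n) powr (-s))) sums deriv zeta_series s"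
    by simp
qed

lemma summable_norm_mangoldt_series:
  assumes s: "Re s > 1"
  shows "summable (\<lambda>n. norm (mangoldt (Suc n) * of_nat (Suc n) powr (-s) :: complex))"
proof (rule summable_comparison_test'[where N = 0])
  define d where "d = (Re s - 1) / 2"
  have d: "d > 0" using s by (simp add: d_def)
  show "summable (\<lambda>n. 1 / d * real (Suc n) powr (-(1 + d)))"
    using d by (intro summable_mult summable_Suc_powr) simp
  fix n
  have "norm (mangoldt (Suc n) * of_nat (Suc n) powr (-s) :: complex) = mangoldt (Suc n) * real (Suc n) powr (- Re s)"
    by (simp only: norm_mult norm_mangoldt norm_of_nat_Suc_powr uminus_complex.simps)
  also have "\<dots> \<le> (real (Suc n) powr d / d) * real (Suc n) powr (- Re s)"
  proof (intro mult_right_mono)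
    have "mangoldt (Suc n) \<le> ln (real (Suc n))" by (rule mangoldt_le) simp
    also have "\<dots> \<le> real (Suc n) powr d / d" using d by (intro ln_powr_bound) auto
    finally show "mangoldt (Suc n) \<le> real (Suc n) powr d / d" .
  qed simp
  also have "\<dots> = 1 / d * (real (Suc n) powr d * real (Suc n) powr (- Re s))" by (simp only: mult_1 times_divide_eq_left)
  also have "real (Suc n) powr d * real (Suc n) powr (- Re s) = real (Suc n) powr (-(1 + d))"
    unfolding powr_add[symmetric] by (rule arg_cong[where f = "\<lambda>x. real (Suc n) powr x"]) (simp add: d_def field_simps)
  finally show "norm (norm (mangoldt (Suc n) * of_nat (Suc n) powr (-s) :: complex)) \<le> 1 / d * real (Suc n) powr (-(1 + d))"
    by simp
qed

text \<open>
  The Dirichlet product of the two series has the coefficients \<open>\<Sum>d | d dvd n. \<Lambda> d = ln n\<close>.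
\<close>

lemma mangoldt_series_times_zeta:
  assumes s: "Re s > 1"
  shows "mangoldt_series s * zeta_series s = - deriv zeta_series s"
proof -
  have "(\<lambda>n. \<Sum>d | d dvd Suc n. (mangoldt d * of_nat d powr (-s)) * of_nat (Suc n div d) powr (-s))
      sums (mangoldt_series s * zeta_series s)"
    by (rule dirichlet_product_sums[OF summable_norm_mangoldt_series[OF s] summable_norm_zeta_series[OF s]])
  moreover have "(\<Sum>d | d dvd Suc n. (mangoldt d * of_nat d powr (-s)) * of_nat (Suc n div d) powr (-s))
      = of_real (ln (real (Suc n))) * of_nat (Suc n) powr (-s)" for n
  proof -
    have "(\<Sum>d | d dvd Suc n. (mangoldt d * of_nat d powr (-s)) * of_nat (Suc n div d) powr (-s))
        = (\<Sum>d | d dvd Suc n. mangoldt d * of_nat (Suc n) powr (-s))"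
    proof (intro sum.cong refl)
      fix d assume "d \<in> {d. d dvd Suc n}"
      hence "d * (Suc n div d) = Suc n" by simp
      hence "complex_of_nat (Suc n) = of_nat d * of_nat (Suc n div d)" by (metis of_nat_mult)
      hence "complex_of_nat (Suc n) powr (-s) = of_nat d powr (-s) * of_nat (Suc n div d) powr (-s)"
        by (simp only:) (intro powr_times_real, auto)
      thus "(mangoldt d * of_nat d powr (-s)) * of_nat (Suc n div d) powr (-s) = mangoldt d * of_nat (Suc n) powr (-s)"
        by (simp only: mult.assoc)
    qed
    also have "\<dots> = (\<Sum>d | d dvd Suc n. mangoldt d) * of_nat (Suc n) powr (-s)"
      by (simp only: sum_distrib_right)
    also have "(\<Sum>d | d dvd Suc n. mangoldt d :: complex) = of_real (ln (real (Suc n)))"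
      by (rule mangoldt_sum) simp
    finally show ?thesis .
  qed
  ultimately have "(\<lambda>n. of_real (ln (real (Suc n))) * of_nat (Suc n) powr (-s)) sums (mangoldt_series s * zeta_series s)"
    by (simp only:)
  moreover have "(\<lambda>n. of_real (ln (real (Suc n))) * of_nat (Suc n) powr (-s)) sums (- deriv zeta_series s)"
    using sums_minus[OF zeta_series_derivative(2)[OF s]] by (simp only: minus_minus)
  ultimately show ?thesis by (rule sums_unique2)
qed

text \<open>
  The identity \<open>\<Sum> \<Lambda>(n) / n powr s = - \<zeta>'(s) / \<zeta>(s)\<close>, rewritten for \<open>(s - 1) \<zeta>(s)\<close> and multiplied
  out, so that it makes sense before \<open>\<zeta>\<close> is known to have no zeros.
\<close>

lemma mangoldt_series_eq:
  assumes s: "Re s > 1"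
  shows "zeta_reg s * mangoldt_series s = zeta_reg s / (s - 1) - deriv zeta_reg s"
proof -
  have s1: "s - 1 \<noteq> 0" using s by auto
  have "((\<lambda>s. (s - 1) * zeta_series s) has_field_derivative (1 * zeta_series s + deriv zeta_series s * (s - 1))) (at s)"
    by (intro DERIV_mult zeta_series_derivative s) (auto intro!: derivative_eq_intros)
  hence "(zeta_reg has_field_derivative (1 * zeta_series s + deriv zeta_series s * (s - 1))) (at s)"
    by (rule has_field_derivative_transform_within_open[where S = "{s. Re s > 1}"])
       (use s in \<open>auto simp: open_halfspace_Re_gt zeta_reg_eq\<close>)
  hence "deriv zeta_reg s = zeta_series s + deriv zeta_series s * (s - 1)"
    by (simp only: DERIV_imp_deriv mult_1)
  moreover have "zeta_reg s / (s - 1) = zeta_series s" 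
    unfolding zeta_reg_eq[OF s] by (rule nonzero_mult_div_cancel_left[OF s1])
  moreover have "zeta_reg s * mangoldt_series s = (s - 1) * - deriv zeta_series s"
    by (simp only: zeta_reg_eq[OF s] mangoldt_series_times_zeta[OF s, symmetric] mult_ac)
  ultimately show ?thesis by (simp only: mult_minus_right mult.commute[of "s - 1"]) simp
qed

section \<open>Absence of zeros on the closed half plane\<close>

text \<open>
  The number \<open>m\<close> is the order of \<open>f\<close> at \<open>z0\<close>: near \<open>z0\<close> the logarithmic derivative is
  \<open>m / (w - z0)\<close> plus a holomorphic function.
\<close>

lemma log_deriv_order_limit:
  fixes f :: "complex \<Rightarrow> complex"
  assumes hol: "f holomorphic_on S" and S: "open S" "connected S" "z0 \<in> S" and nz: "\<exists>w\<in>S. f w \<noteq> 0"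
  obtains m :: nat where "m = 0 \<longleftrightarrow> f z0 \<noteq> 0"
    "((\<lambda>\<epsilon>. of_real \<epsilon> * (deriv f (z0 + of_real \<epsilon>) / f (z0 + of_real \<epsilon>))) \<longlongrightarrow> of_nat m) (at_right 0)"
    "\<forall>\<^sub>F \<epsilon> in at_right 0. f (z0 + of_real \<epsilon>) \<noteq> 0"
proof -
  define n where "n = zorder f z0"
  define g where "g = zor_poly f z0"
  define k where "k = nat n"
  from zorder_exist_zero[OF hol S nz, folded n_def g_def, folded k_def]
  obtain r where n: "if f z0 = 0 then n > 0 else n = 0" and r: "r > 0" "cball z0 r \<subseteq> S" "g holomorphic_on cball z0 r"
    and fg: "\<forall>w\<in>cball z0 r. f w = g w * (w - z0) ^ k \<and> g w \<noteq> 0" by (elim conjE exE) (rule that)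
  have k0: "k = 0 \<longleftrightarrow> f z0 \<noteq> 0" using n by (auto simp: k_def split: if_splits)
  have gh: "g holomorphic_on ball z0 r" using r(3) by (rule holomorphic_on_subset) auto
  have small: "\<forall>\<^sub>F \<epsilon> in at_right 0. \<epsilon> > 0 \<and> \<epsilon> < r"
    using r(1) eventually_at_right_real[of 0 r] by (auto elim: eventually_mono)
  have inball: "z0 + of_real \<epsilon> \<in> ball z0 r" if "\<epsilon> > 0 \<and> \<epsilon> < r" for \<epsilon>
    using that by (simp add: dist_norm)
  have "\<forall>\<^sub>F \<epsilon> in at_right 0. f (z0 + of_real \<epsilon>) \<noteq> 0"
    using small
  proof eventually_elim
    case (elim \<epsilon>)
    have "f (z0 + of_real \<epsilon>) = g (z0 + of_real \<epsilon>) * (z0 + of_real \<epsilon> - z0) ^ k" "g (z0 + of_real \<epsilon>) \<noteq> 0"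
      using fg inball[OF elim] by auto
    thus ?case using elim by simp
  qed
  moreover have "((\<lambda>\<epsilon>. of_real \<epsilon> * (deriv f (z0 + of_real \<epsilon>) / f (z0 + of_real \<epsilon>))) \<longlongrightarrow> of_nat k) (at_right 0)"
  proof (rule Lim_transform_eventually)
    have "isCont (\<lambda>w. deriv g w / g w) z0"
    proof (intro continuous_divide holomorphic_on_imp_continuous_on[THEN continuous_on_interior])
      show "deriv g holomorphic_on ball z0 r" by (intro holomorphic_deriv gh) auto
      show "g holomorphic_on ball z0 r" by (rule gh)
    qed (use r fg in auto)
    moreover have "((\<lambda>\<epsilon>. z0 + of_real \<epsilon>) \<longlongrightarrow> z0 + of_real 0) (at_right (0::real))"
      by (intro tendsto_intros)
    ultimately have "((\<lambda>\<epsilon>. deriv g (z0 + of_real \<epsilon>) / g (z0 + of_real \<epsilon>)) \<longlongrightarrow> deriv g z0 / g z0) (at_right (0::real))"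
      using isCont_tendsto_compose[of z0 "\<lambda>w. deriv g w / g w" "\<lambda>\<epsilon>. z0 + of_real \<epsilon>" "at_right 0"] by simp
    hence "((\<lambda>\<epsilon>. of_real \<epsilon> * (deriv g (z0 + of_real \<epsilon>) / g (z0 + of_real \<epsilon>)) + of_nat k) \<longlongrightarrow>
        of_real 0 * (deriv g z0 / g z0) + of_nat k) (at_right (0::real))"
      by (intro tendsto_add tendsto_mult tendsto_const tendsto_of_real tendsto_ident_at)
    thus "((\<lambda>\<epsilon>. of_real \<epsilon> * (deriv g (z0 + of_real \<epsilon>) / g (z0 + of_real \<epsilon>)) + of_nat k) \<longlongrightarrow> of_nat k) (at_right (0::real))"
      by simp
    show "\<forall>\<^sub>F \<epsilon> in at_right 0. of_real \<epsilon> * (deriv g (z0 + of_real \<epsilon>) / g (z0 + of_real \<epsilon>)) + of_nat k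
        = of_real \<epsilon> * (deriv f (z0 + of_real \<epsilon>) / f (z0 + of_real \<epsilon>))"
      using small
    proof eventually_elim
      case (elim \<epsilon>)
      define w where "w = z0 + complex_of_real \<epsilon>"
      have w: "w \<in> ball z0 r" using inball[OF elim] by (simp add: w_def)
      have e: "w - z0 = of_real \<epsilon>" by (simp add: w_def)
      have gw: "g w \<noteq> 0" "f w = g w * of_real \<epsilon> ^ k" using fg w e by auto
      have "((\<lambda>w. g w * (w - z0) ^ k) has_field_derivative
          deriv g w * (w - z0) ^ k + (of_nat k * (w - z0) ^ (k - 1) * 1) * g w) (at w)"
        by (intro DERIV_mult holomorphic_derivI[OF gh open_ball w]) (auto intro!: derivative_eq_intros)
      hence "(f has_field_derivative
          deriv g w * (w - z0) ^ k + (of_nat k * (w - z0) ^ (k - 1) * 1) * g w) (at w)"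
        by (rule has_field_derivative_transform_within_open[OF _ open_ball w]) (use fg in auto)
      hence d: "deriv f w = deriv g w * of_real \<epsilon> ^ k + of_nat k * of_real \<epsilon> ^ (k - 1) * g w"
        by (simp only: e DERIV_imp_deriv mult_1_right)
      have p: "complex_of_real \<epsilon> * (of_nat k * of_real \<epsilon> ^ (k - 1)) = of_nat k * of_real \<epsilon> ^ k"
        by (cases k) simp_all
      have "of_real \<epsilon> * deriv f w = of_real \<epsilon> * deriv g w * of_real \<epsilon> ^ k + (complex_of_real \<epsilon> * (of_nat k * of_real \<epsilon> ^ (k - 1))) * g w"
        by (simp only: d distrib_left mult.assoc)
      also have "\<dots> = (of_real \<epsilon> * (deriv g w / g w) + of_nat k) * f w"
        unfolding p using gw by (simp add: field_simps)
      finally have "of_real \<epsilon> * deriv f w = (of_real \<epsilon> * (deriv g w / g w) + of_nat k) * f w" .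
      moreover have "f w \<noteq> 0" using gw elim by simp
      ultimately have "of_real \<epsilon> * (deriv g w / g w) + of_nat k = of_real \<epsilon> * (deriv f w / f w)"
        by (simp add: nonzero_eq_divide_eq)
      thus ?case by (simp only: w_def)
    qed
  qed
  ultimately show ?thesis using that[OF k0] by blast
qed

lemma mangoldt_series_boundary_limit:
  assumes "Re z0 \<ge> 1"
  obtains m :: nat where "m = 0 \<longleftrightarrow> zeta_reg z0 \<noteq> 0"
    "((\<lambda>\<epsilon>. of_real \<epsilon> * mangoldt_series (z0 + of_real \<epsilon>)) \<longlongrightarrow> (if z0 = 1 then 1 else 0) - of_nat m) (at_right 0)"
proof -
  let ?S = "{s. Re s > 0}"
  have "open ?S" "connected ?S" "z0 \<in> ?S" "\<exists>w\<in>?S. zeta_reg w \<noteq> 0"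
    using assms by (auto intro!: convex_connected convex_halfspace_Re_gt open_halfspace_Re_gt exI[of _ 1])
  from log_deriv_order_limit[OF holomorphic_zeta_reg this]
  obtain m :: nat where m: "m = 0 \<longleftrightarrow> zeta_reg z0 \<noteq> 0"
    "((\<lambda>\<epsilon>. of_real \<epsilon> * (deriv zeta_reg (z0 + of_real \<epsilon>) / zeta_reg (z0 + of_real \<epsilon>))) \<longlongrightarrow> of_nat m) (at_right 0)"
    "\<forall>\<^sub>F \<epsilon> in at_right 0. zeta_reg (z0 + of_real \<epsilon>) \<noteq> 0" .
  have pole: "((\<lambda>\<epsilon>. of_real \<epsilon> / (z0 + of_real \<epsilon> - 1)) \<longlongrightarrow> (if z0 = 1 then 1 else 0)) (at_right 0)"
  proof (cases "z0 = 1")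
    case True
    have "\<forall>\<^sub>F \<epsilon> in at_right (0::real). 1 = of_real \<epsilon> / (z0 + of_real \<epsilon> - 1)"
      using eventually_at_right_less[of 0] by eventually_elim (simp add: True)
    thus ?thesis using True by (auto intro: Lim_transform_eventually[OF tendsto_const])
  next
    case False
    have "((\<lambda>\<epsilon>. of_real \<epsilon> / (z0 + of_real \<epsilon> - 1)) \<longlongrightarrow> of_real 0 / (z0 + of_real 0 - 1)) (at_right (0::real))"
      using False by (intro tendsto_intros) auto
    thus ?thesis using False by simp
  qed
  have "((\<lambda>\<epsilon>. of_real \<epsilon> * mangoldt_series (z0 + of_real \<epsilon>)) \<longlongrightarrow> (if z0 = 1 then 1 else 0) - of_nat m) (at_right 0)"
  proof (rule Lim_transform_eventually[OF tendsto_diff[OF pole m(2)]])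
    show "\<forall>\<^sub>F \<epsilon> in at_right 0. of_real \<epsilon> / (z0 + of_real \<epsilon> - 1) -
       of_real \<epsilon> * (deriv zeta_reg (z0 + of_real \<epsilon>) / zeta_reg (z0 + of_real \<epsilon>)) = of_real \<epsilon> * mangoldt_series (z0 + of_real \<epsilon>)"
      using m(3) eventually_at_right_less[of 0]
    proof eventually_elim
      case (elim \<epsilon>)
      define w where "w = z0 + complex_of_real \<epsilon>"
      have w: "Re w > 1" using elim assms by (simp add: w_def)
      define D where "D = deriv zeta_reg w"
      define L where "L = mangoldt_series w"
      define q where "q = w - 1"
      have q: "q \<noteq> 0" using w by (auto simp: q_def)
      have Z: "zeta_reg w \<noteq> 0" using elim by (simp add: w_def)
      have "zeta_reg w * L = zeta_reg w / q - D"
        unfolding L_def q_def D_def by (rule mangoldt_series_eq[OF w])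
      hence L: "L = 1 / q - D / zeta_reg w" using Z q by (simp add: field_simps)
      have "of_real \<epsilon> / q - of_real \<epsilon> * (D / zeta_reg w) = of_real \<epsilon> * L"
        unfolding L by (simp add: right_diff_distrib)
      thus ?case by (simp only: q_def D_def L_def w_def)
    qed
  qed
  with m(1) show ?thesis by (rule that)
qed

text \<open>
  Termwise, with \<open>c\<close> the cosine of \<open>t * ln n\<close>, the combination is a nonnegative multiple of
  \<open>3 + 4 c + (2 c\<^sup>2 - 1) = 2 (1 + c)\<^sup>2\<close>.
\<close>

lemma mangoldt_series_341:
  assumes s: "\<sigma> > 1"
  shows "3 * Re (mangoldt_series (of_real \<sigma>)) + 4 * Re (mangoldt_series (Complex \<sigma> t))
     + Re (mangoldt_series (Complex \<sigma> (2 * t))) \<ge> 0"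
proof -
  have re: "(\<lambda>n. mangoldt (Suc n) * (real (Suc n) powr (-\<sigma>) * cos (u * ln (real (Suc n))))) sums Re (mangoldt_series (Complex \<sigma> u))" for u
  proof -
    have "summable (\<lambda>n. mangoldt (Suc n) * of_nat (Suc n) powr (- Complex \<sigma> u) :: complex)"
      by (rule summable_norm_cancel, rule summable_norm_mangoldt_series) (use s in simp)
    from sums_Re[OF summable_sums[OF this]]
    have "(\<lambda>n. Re (mangoldt (Suc n) * of_nat (Suc n) powr (- Complex \<sigma> u))) sums Re (mangoldt_series (Complex \<sigma> u))" .
    moreover have "Re (mangoldt (Suc n) * of_nat (Suc n) powr (- Complex \<sigma> u))
        = mangoldt (Suc n) * (real (Suc n) powr (-\<sigma>) * cos (u * ln (real (Suc n))))" for n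
    proof -
      have L: "Ln (of_nat (Suc n)) = of_real (ln (real (Suc n)))"
        using Ln_of_real[of "real (Suc n)"] by (simp del: of_nat_Suc)
      have "Re (of_nat (Suc n) powr (- Complex \<sigma> u)) = real (Suc n) powr (-\<sigma>) * cos (u * ln (real (Suc n)))"
        by (simp add: powr_def L Re_exp del: of_nat_Suc)
      thus ?thesis by (simp only: times_complex.simps Re_mangoldt Im_mangoldt mult_zero_left diff_0_right)
    qed
    ultimately show ?thesis by (simp only:)
  qed
  have "(\<lambda>n. 3 * (mangoldt (Suc n) * (real (Suc n) powr (-\<sigma>) * cos (0 * ln (real (Suc n))))) +
      4 * (mangoldt (Suc n) * (real (Suc n) powr (-\<sigma>) * cos (t * ln (real (Suc n))))) +
      mangoldt (Suc n) * (real (Suc n) powr (-\<sigma>) * cos ((2 * t) * ln (real (Suc n)))))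
    sums (3 * Re (mangoldt_series (Complex \<sigma> 0)) + 4 * Re (mangoldt_series (Complex \<sigma> t))
     + Re (mangoldt_series (Complex \<sigma> (2 * t))))"
    by (intro sums_add sums_mult re)
  moreover have "0 \<le> 3 * (mangoldt (Suc n) * (real (Suc n) powr (-\<sigma>) * cos (0 * ln (real (Suc n))))) +
      4 * (mangoldt (Suc n) * (real (Suc n) powr (-\<sigma>) * cos (t * ln (real (Suc n))))) +
      mangoldt (Suc n) * (real (Suc n) powr (-\<sigma>) * cos ((2 * t) * ln (real (Suc n))))" for n
  proof -
    define c where "c = cos (t * ln (real (Suc n)))"
    define a where "a = mangoldt (Suc n) * real (Suc n) powr (-\<sigma>)"
    have "cos ((2 * t) * ln (real (Suc n))) = 2 * c\<^sup>2 - 1"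
      using cos_double_cos[of "t * ln (real (Suc n))"] by (simp add: c_def mult.assoc del: of_nat_Suc)
    moreover have "a * (2 * (1 + c)\<^sup>2) \<ge> 0" by (simp add: a_def mangoldt_nonneg)
    moreover have "a * (2 * (1 + c)\<^sup>2) = 3 * a + 4 * (a * c) + a * (2 * c\<^sup>2 - 1)"
      by (simp add: algebra_simps power2_eq_square)
    ultimately show ?thesis by (simp add: a_def c_def mult.assoc del: of_nat_Suc)
  qed
  ultimately have "0 \<le> 3 * Re (mangoldt_series (Complex \<sigma> 0)) + 4 * Re (mangoldt_series (Complex \<sigma> t))
     + Re (mangoldt_series (Complex \<sigma> (2 * t)))"
    by (rule sums_le[OF _ sums_zero, rotated])
  thus ?thesis by (simp only: complex_of_real_def)
qed

text \<open>
  Let \<open>m1\<close> be the order of the zero at \<open>s = \<sigma> + t \<i>\<close>. Multiplying \<open>mangoldt_series_341\<close> at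
  \<open>\<sigma> + \<epsilon>\<close> by \<open>\<epsilon>\<close> and letting \<open>\<epsilon>\<close> tend to \<open>0\<close> gives
  \<open>0 \<le> 3 (c - m0) - 4 m1 - m2\<close>, where \<open>m0\<close> and \<open>m2\<close> are orders as well and \<open>c \<le> 1\<close> comes from the
  pole. Hence \<open>4 m1 \<le> 3\<close>. This treats the boundary line and the half plane \<open>Re s > 1\<close> at once.
\<close>

theorem zeta_reg_nonzero:
  assumes s: "Re s \<ge> 1"
  shows "zeta_reg s \<noteq> 0"
proof (cases "s = 1")
  case False
  define \<sigma> t where "\<sigma> = Re s" and "t = Im s"
  have st: "s = Complex \<sigma> t" "\<sigma> \<ge> 1" using s by (auto simp: \<sigma>_def t_def)
  obtain m0 where m0: "((\<lambda>\<epsilon>. of_real \<epsilon> * mangoldt_series (of_real \<sigma> + of_real \<epsilon>)) \<longlongrightarrow>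
      (if complex_of_real \<sigma> = 1 then 1 else 0) - of_nat m0) (at_right 0)"
    by (rule mangoldt_series_boundary_limit[of "of_real \<sigma>"]) (use st in auto)
  obtain m1 where m1: "m1 = 0 \<longleftrightarrow> zeta_reg s \<noteq> 0" "((\<lambda>\<epsilon>. of_real \<epsilon> * mangoldt_series (s + of_real \<epsilon>)) \<longlongrightarrow>
      (if s = 1 then 1 else 0) - of_nat m1) (at_right 0)"
    by (rule mangoldt_series_boundary_limit[OF s])
  obtain m2 where m2: "((\<lambda>\<epsilon>. of_real \<epsilon> * mangoldt_series (Complex \<sigma> (2 * t) + of_real \<epsilon>)) \<longlongrightarrow>
      (if Complex \<sigma> (2 * t) = 1 then 1 else 0) - of_nat m2) (at_right 0)"
    by (rule mangoldt_series_boundary_limit[of "Complex \<sigma> (2 * t)"]) (use st in auto)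
  have n1: "Complex \<sigma> (2 * t) \<noteq> 1" using False st by (auto simp: complex_eq_iff)
  define c where "c = (if complex_of_real \<sigma> = 1 then 1 else 0 :: complex)"
  have "((\<lambda>\<epsilon>. 3 * Re (of_real \<epsilon> * mangoldt_series (of_real \<sigma> + of_real \<epsilon>))
      + 4 * Re (of_real \<epsilon> * mangoldt_series (s + of_real \<epsilon>))
      + Re (of_real \<epsilon> * mangoldt_series (Complex \<sigma> (2 * t) + of_real \<epsilon>)))
      \<longlongrightarrow> 3 * Re (c - of_nat m0) + 4 * Re (0 - of_nat m1) + Re (0 - of_nat m2)) (at_right 0)"
    using m0 m1(2) m2 False n1 unfolding c_def by (intro tendsto_intros) simp_all
  moreover have "\<forall>\<^sub>F \<epsilon> in at_right 0. 0 \<le> 3 * Re (of_real \<epsilon> * mangoldt_series (of_real \<sigma> + of_real \<epsilon>))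
      + 4 * Re (of_real \<epsilon> * mangoldt_series (s + of_real \<epsilon>))
      + Re (of_real \<epsilon> * mangoldt_series (Complex \<sigma> (2 * t) + of_real \<epsilon>))"
    using eventually_at_right_less[of 0]
  proof eventually_elim
    case (elim \<epsilon>)
    have shift: "complex_of_real \<sigma> + of_real \<epsilon> = of_real (\<sigma> + \<epsilon>)" "s + of_real \<epsilon> = Complex (\<sigma> + \<epsilon>) t"
      "Complex \<sigma> (2 * t) + of_real \<epsilon> = Complex (\<sigma> + \<epsilon>) (2 * t)"
      by (simp_all add: st complex_eq_iff)
    have "\<epsilon> * (3 * Re (mangoldt_series (of_real (\<sigma> + \<epsilon>))) + 4 * Re (mangoldt_series (Complex (\<sigma> + \<epsilon>) t))
     + Re (mangoldt_series (Complex (\<sigma> + \<epsilon>) (2 * t)))) \<ge> 0"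
      using elim st by (intro mult_nonneg_nonneg mangoldt_series_341) auto
    moreover have re: "Re (of_real \<epsilon> * z) = \<epsilon> * Re z" for z by simp
    ultimately show ?case unfolding shift re by (simp only: distrib_left mult.left_commute)
  qed
  ultimately have "0 \<le> 3 * Re (c - of_nat m0) + 4 * Re (0 - of_nat m1) + Re (0 - of_nat m2)"
    by (rule tendsto_lowerbound) simp
  moreover have "Re c \<le> 1" by (simp add: c_def)
  ultimately have "4 * real m1 \<le> 3" by simp
  hence "m1 = 0" by simp
  thus ?thesis using m1(1) by simp
qed simp

section \<open>The prime number theorem for Chebyshev's function\<close>

definition psi :: "nat \<Rightarrow> real" where
  "psi n = (\<Sum>k\<le>n. mangoldt k)"

lemma psi_0 [simp]: "psi 0 = 0" by (simp add: psi_def)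

lemma psi_Suc: "psi (Suc n) = psi n + mangoldt (Suc n)" by (simp add: psi_def)

lemma mono_psi: "mono psi"
  by (rule monoI, unfold psi_def, rule sum_mono2) (auto simp: mangoldt_nonneg)

lemma psi_nonneg: "psi n \<ge> 0"
  by (simp add: psi_def sum_nonneg mangoldt_nonneg)

text \<open>
  Passing from \<open>N\<close> to \<open>Suc N\<close> raises \<open>N div d\<close> exactly for the divisors \<open>d\<close> of \<open>Suc N\<close>, and
  \<open>\<Lambda>\<close> sums to \<open>ln (Suc N)\<close> over these. The range of summation is a separate parameter so that the
  identities for \<open>2 * m\<close> and for \<open>m\<close> can be subtracted termwise.
\<close>

lemma ln_fact_eq_sum_mangoldt:
  "N \<le> M \<Longrightarrow> ln (fact N :: real) = (\<Sum>d=1..M. mangoldt d * real (N div d))"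
proof (induction N)
  case 0
  show ?case by simp
next
  case (Suc N)
  have "(\<Sum>d=1..M. mangoldt d * real (Suc N div d))
      = (\<Sum>d=1..M. mangoldt d * real (N div d) + (if d dvd Suc N then mangoldt d else 0))"
    by (intro sum.cong refl) (auto simp: div_Suc dvd_eq_mod_eq_0 algebra_simps)
  also have "\<dots> = ln (fact N :: real) + (\<Sum>d=1..M. if d dvd Suc N then mangoldt d else 0)"
    using Suc by (simp add: sum.distrib)
  also have "(\<Sum>d=1..M. if d dvd Suc N then mangoldt d else 0) = (\<Sum>d | d dvd Suc N. mangoldt d :: real)"
  proof -
    have "1 \<le> d \<and> d \<le> M" if "d dvd Suc N" for d
      using that Suc.prems dvd_imp_le[OF that] dvd_pos_nat[OF _ that] by simp
    hence "{d. d dvd Suc N} = {d\<in>{1..M}. d dvd Suc N}" by auto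
    thus ?thesis by (simp only: sum.inter_filter finite_atLeastAtMost)
  qed
  also have "\<dots> = ln (real (Suc N))" using mangoldt_sum[of "Suc N", where ?'a = real] by simp
  finally show ?case
    by (simp add: ln_mult add.commute del: of_nat_Suc)
qed

text \<open>
  Chebyshev's argument: in \<open>ln (2 * m choose m)\<close> the coefficient of \<open>\<Lambda> d\<close> is
  \<open>2 * m div d - 2 * (m div d)\<close>, which is never negative and is at least \<open>1\<close> for
  \<open>m < d \<le> 2 * m\<close>.
\<close>

lemma psi_double_le: "psi (2 * m) \<le> psi m + 2 * real m * ln 2"
proof -
  have "psi (2 * m) - psi m = (\<Sum>d\<in>{m<..2*m}. mangoldt d)"
  proof -
    have "{..2*m} = {..m} \<union> {m<..2*m}" by auto
    moreover have "sum mangoldt ({..m} \<union> {m<..2*m}) = sum mangoldt {..m} + (sum mangoldt {m<..2*m} :: real)"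
      by (rule sum.union_disjoint) auto
    ultimately show ?thesis by (simp add: psi_def)
  qed
  also have "\<dots> \<le> (\<Sum>d\<in>{m<..2*m}. mangoldt d * (real ((2*m) div d) - 2 * real (m div d)))"
  proof (intro sum_mono)
    fix d assume d: "d \<in> {m<..2*m}"
    hence "m div d = 0" "(2*m) div d \<ge> 1" by (auto simp: div_greater_zero_iff Suc_le_eq)
    hence "real ((2*m) div d) - 2 * real (m div d) \<ge> 1" by simp
    from mult_left_mono[OF this mangoldt_nonneg[of d]]
    show "mangoldt d \<le> mangoldt d * (real ((2*m) div d) - 2 * real (m div d))" by simp
  qed
  also have "\<dots> \<le> (\<Sum>d=1..2*m. mangoldt d * (real ((2*m) div d) - 2 * real (m div d)))"
  proof (intro sum_mono2)
    fix d
    have "2 * (m div d) \<le> (2 * m) div d"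
      using div_mult1_eq[of 2 m d] by simp
    hence "real ((2*m) div d) - 2 * real (m div d) \<ge> 0"
      by (simp add: of_nat_mono[where ?'a = real] flip: of_nat_mult[of 2, simplified])
    thus "0 \<le> mangoldt d * (real ((2*m) div d) - 2 * real (m div d))"
      by (intro mult_nonneg_nonneg mangoldt_nonneg)
  qed auto
  also have "\<dots> = ln (fact (2*m) :: real) - 2 * ln (fact m :: real)"
    using ln_fact_eq_sum_mangoldt[of "2*m" "2*m"] ln_fact_eq_sum_mangoldt[of m "2*m"]
    by (simp add: sum_subtractf sum_distrib_left right_diff_distrib mult_ac)
  also have "\<dots> = ln (real ((2*m) choose m))"
  proof -
    have "fact m * fact m * real ((2*m) choose m) = fact (2*m)"
      using binomial_fact_lemma[of m "2*m"] by (metis add_diff_cancel_right' le_add2 mult_2 of_nat_fact of_nat_mult)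
    hence "ln (fact (2*m) :: real) = ln (fact m * fact m * real ((2*m) choose m))" by simp
    also have "\<dots> = ln (fact m :: real) + ln (fact m :: real) + ln (real ((2*m) choose m))"
      by (simp add: ln_mult)
    finally show ?thesis by simp
  qed
  also have "\<dots> \<le> ln (2 ^ (2 * m))"
  proof -
    have "(2*m) choose m \<le> 2 ^ (2*m)" by (rule binomial_le_pow2)
    hence "real ((2*m) choose m) \<le> real (2 ^ (2*m))" by (simp only: of_nat_le_iff)
    thus ?thesis by simp
  qed
  also have "\<dots> = 2 * real m * ln 2" by (simp add: ln_realpow)
  finally show ?thesis by simp
qed

lemma psi_le: "psi n \<le> 4 * real n"
proof (induction n rule: less_induct)
  case (less n)
  show ?case
  proof (cases "n = 0")
    case False
    define m where "m = n div 2"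
    have IH: "psi m \<le> 4 * real m" using False by (intro less) (auto simp: m_def)
    have "2 * real m * ln 2 \<le> 2 * real m * 1" using ln_2_less_1 by (intro mult_left_mono) auto
    hence dbl: "psi (2 * m) \<le> 6 * real m" using psi_double_le[of m] IH by linarith
    consider "n = 2 * m" | "n = Suc (2 * m)" by (fastforce simp: m_def)
    thus ?thesis
    proof cases
      case 1
      thus ?thesis using dbl by simp
    next
      case 2
      have "mangoldt (Suc (2*m)) \<le> ln (real (Suc (2*m)))" by (rule mangoldt_le) simp
      also have "\<dots> \<le> 2 * real m" using ln_add_one_self_le_self[of "2 * real m"] by (simp add: add.commute)
      finally show ?thesis using dbl by (simp add: 2 psi_Suc)
    qed
  qed simp
qed

text \<open>
  If \<open>p n \<ge> (1 + 2 * d) * n\<close>, then by monotonicity \<open>p m - m \<ge> d * n\<close> for all \<open>m\<close> from \<open>n\<close> to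
  \<open>(1 + d) * n\<close>, and these terms alone add up to at least \<open>d\<^sup>2 / 4\<close>. For large \<open>n\<close> this
  contradicts the Cauchy criterion. If \<open>p n\<close> is too small, the terms from \<open>(1 - d) * n\<close> to \<open>n\<close>
  lead to a contradiction in the same way.
\<close>

lemma tendsto_one_if_mono_summable:
  fixes p :: "nat \<Rightarrow> real"
  assumes mono: "mono p" and summ: "summable (\<lambda>n. (p (Suc n) - real (Suc n)) / (real (Suc n))\<^sup>2)"
  shows "(\<lambda>n. p n / real n) \<longlonglongrightarrow> 1"
proof -
  let ?f = "\<lambda>n. (p (Suc n) - real (Suc n)) / (real (Suc n))\<^sup>2"
  have key: "\<forall>\<^sub>F n in sequentially. (1 - 2 * d) * real n < p n \<and> p n < (1 + 2 * d) * real n"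
    if d: "0 < d" "d < 1/2" for d :: real
  proof -
    have "d\<^sup>2 / 4 > 0" using d by simp
    from summ[unfolded summable_Cauchy, rule_format, OF this]
    obtain M where "\<forall>m\<ge>M. \<forall>n. norm (sum ?f {m..<n}) < d\<^sup>2 / 4" ..
    hence M: "norm (sum ?f {m..<n}) < d\<^sup>2 / 4" if "m \<ge> M" for m n using that by simp
    have "(1 - 2 * d) * real n < p n \<and> p n < (1 + 2 * d) * real n" if n: "n \<ge> 2 * M + 4" for n
    proof (intro conjI; rule ccontr)
      have n0: "real n > 0" using n by simp
      assume "\<not> p n < (1 + 2 * d) * real n"
      hence big: "p n \<ge> (1 + 2 * d) * real n" by simp
      define k where "k = nat \<lfloor>(1 + d) * real n\<rfloor>"
      have k: "real k \<le> (1 + d) * real n" "real k > (1 + d) * real n - 1"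
      proof -
        have "real k = real_of_int \<lfloor>(1 + d) * real n\<rfloor>" using d by (simp add: k_def)
        thus "real k \<le> (1 + d) * real n" "real k > (1 + d) * real n - 1" by linarith+
      qed
      have "(\<Sum>j\<in>{n-1..<k}. d / (4 * real n)) \<le> sum ?f {n-1..<k}"
      proof (intro sum_mono)
        fix j assume j: "j \<in> {n-1..<k}"
        define m where "m = real (Suc j)"
        have m: "real n \<le> m" "m \<le> (1 + d) * real n" using j n k(1) by (auto simp: m_def)
        have "(1 + d) * real n \<le> 2 * real n" using d by (intro mult_right_mono) auto
        hence "m \<le> 2 * real n" using m(2) by linarith
        hence m2: "m\<^sup>2 \<le> (2 * real n)\<^sup>2" using m n0 by (intro power_mono) auto
        have "p n \<le> p (Suc j)" using j n by (intro monoD[OF mono]) auto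
        hence "p (Suc j) - m \<ge> d * real n" using big m(2) by (simp add: algebra_simps)
        moreover have "d / (4 * real n) = d * real n / (2 * real n)\<^sup>2"
          using n0 by (simp add: power2_eq_square)
        moreover have "\<dots> \<le> d * real n / m\<^sup>2"
          using m2 d n0 m by (intro divide_left_mono mult_nonneg_nonneg mult_pos_pos) auto
        moreover have "d * real n / m\<^sup>2 \<le> (p (Suc j) - m) / m\<^sup>2"
          using calculation(1) by (intro divide_right_mono) auto
        ultimately show "d / (4 * real n) \<le> ?f j" unfolding m_def by linarith
      qed
      moreover have "d\<^sup>2 / 4 \<le> (\<Sum>j\<in>{n-1..<k}. d / (4 * real n))"
      proof -
        have "d * real n \<le> real (k - (n - 1))" using k n by (simp add: of_nat_diff algebra_simps) 
        hence "d * real n * (d / (4 * real n)) \<le> real (k - (n - 1)) * (d / (4 * real n))"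
          using d n0 by (intro mult_right_mono) auto
        moreover have "d * real n * (d / (4 * real n)) = d\<^sup>2 / 4" using n0 by (simp add: power2_eq_square)
        ultimately show ?thesis by (simp only: sum_constant card_atLeastLessThan)
      qed
      moreover have "M \<le> n - 1" using n by linarith
      note M[OF this, of k]
      ultimately show False unfolding real_norm_def by linarith
    next
      have n0: "real n > 0" using n by simp
      assume "\<not> (1 - 2 * d) * real n < p n"
      hence small: "p n \<le> (1 - 2 * d) * real n" by simp
      define k where "k = nat \<lceil>(1 - d) * real n\<rceil>"
      have k: "real k \<ge> (1 - d) * real n" "real k < (1 - d) * real n + 1"
      proof -
        have "0 \<le> (1 - d) * real n" using d by simp
        hence "real k = real_of_int \<lceil>(1 - d) * real n\<rceil>" unfolding k_def by (intro of_nat_nat) linarith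
        thus "real k \<ge> (1 - d) * real n" "real k < (1 - d) * real n + 1" by linarith+
      qed
      have "(1 - d) * real n \<ge> 1/2 * real n" using d by (intro mult_right_mono) auto
      hence "real k \<ge> real (M + 2)" using k(1) n by linarith
      hence kM: "k \<ge> M + 2" by (simp only: of_nat_le_iff)
      have "sum ?f {k-1..<n} \<le> (\<Sum>j\<in>{k-1..<n}. - (d / real n))"
      proof (intro sum_mono)
        fix j assume j: "j \<in> {k-1..<n}"
        define m where "m = real (Suc j)"
        have m: "m \<le> real n" "(1 - d) * real n \<le> m" "m > 0" using j kM k(1) by (auto simp: m_def)
        have "m\<^sup>2 \<le> (real n)\<^sup>2" using m by (intro power_mono) auto
        have "p (Suc j) \<le> p n" using j by (intro monoD[OF mono]) auto
        hence "d * real n \<le> m - p (Suc j)" using small m(2) by (simp add: algebra_simps)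
        moreover have "d / real n = d * real n / (real n)\<^sup>2"
          using n0 by (simp add: power2_eq_square)
        moreover have "\<dots> \<le> d * real n / m\<^sup>2"
          using \<open>m\<^sup>2 \<le> (real n)\<^sup>2\<close> d n0 m by (intro divide_left_mono mult_nonneg_nonneg mult_pos_pos) auto
        moreover have "d * real n / m\<^sup>2 \<le> (m - p (Suc j)) / m\<^sup>2"
          using calculation(1) by (intro divide_right_mono) auto
        moreover have "?f j = - ((m - p (Suc j)) / m\<^sup>2)"
          unfolding m_def by (simp only: minus_divide_left minus_diff_eq)
        ultimately show "?f j \<le> - (d / real n)" by linarith
      qed
      moreover have "d\<^sup>2 \<le> (\<Sum>j\<in>{k-1..<n}. d / real n)"
      proof -
        have "d * real n \<le> real n - real k + 1" using k by (simp add: algebra_simps)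
        also have "\<dots> \<le> real (n - (k - 1))" using kM by linarith
        finally have "d * real n * (d / real n) \<le> real (n - (k - 1)) * (d / real n)"
          using d n0 by (intro mult_right_mono) auto
        moreover have "d * real n * (d / real n) = d\<^sup>2" using n0 by (simp add: power2_eq_square)
        ultimately show ?thesis by (simp only: sum_constant card_atLeastLessThan)
      qed
      moreover have "d\<^sup>2 / 4 \<le> d\<^sup>2" by simp
      moreover have "M \<le> k - 1" using kM by linarith
      note M[OF this, of n]
      ultimately show False unfolding real_norm_def sum_negf by linarith
    qed
    thus ?thesis unfolding eventually_at_top_linorder by (intro exI[of _ "2 * M + 4"] allI impI)
  qed
  show ?thesis
  proof (rule tendstoI)
    fix e :: real assume e: "e > 0"
    define d where "d = min (e / 4) (1 / 4)"
    have d: "0 < d" "d < 1/2" "2 * d < e" using e by (auto simp: d_def)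
    show "\<forall>\<^sub>F n in sequentially. dist (p n / real n) 1 < e"
      using key[OF d(1,2)] eventually_gt_at_top[of 0]
    proof eventually_elim
      case (elim n)
      have "p n / real n < 1 + 2 * d" "p n / real n > 1 - 2 * d"
        using elim by (simp_all add: divide_less_eq less_divide_eq)
      thus ?case using d(3) unfolding dist_real_def by linarith
    qed
  qed
qed

lemma psi_minus_id_partial_summation:
  fixes s :: complex
  shows "(\<Sum>n<N. (mangoldt (Suc n) - 1) * of_nat (Suc n) powr (-s))
    = (\<Sum>n<N. of_real (psi (Suc n) - real (Suc n)) * (of_nat (Suc n) powr (-s) - of_nat (Suc (Suc n)) powr (-s)))
      + of_real (psi N - real N) * of_nat (Suc N) powr (-s)"
proof (induction N)
  case 0
  show ?case by simp
next
  case (Suc N)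
  define x y where "x = complex_of_nat (Suc N) powr (-s)" and "y = complex_of_nat (Suc (Suc N)) powr (-s)"
  have d: "complex_of_real (psi (Suc N) - real (Suc N)) = of_real (psi N - real N) + (mangoldt (Suc N) - 1)"
    by (simp add: psi_Suc)
  have step: "(mangoldt (Suc N) - 1) * x + of_real (psi N - real N) * x
     = of_real (psi (Suc N) - real (Suc N)) * (x - y) + of_real (psi (Suc N) - real (Suc N)) * y"
    unfolding d by (simp only: ring_distribs) simp
  have "S + A = T + C + D" if "S = T + B" "A + B = C + D" for S T A B C D :: complex
  proof -
    have "S + A = T + (A + B)" unfolding that(1) by (simp only: add_ac)
    thus ?thesis unfolding that(2) by (simp only: add.assoc)
  qed
  from this[OF Suc.IH step[unfolded x_def y_def]] show ?case unfolding sum.lessThan_Suc .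
qed

lemma abs_psi_minus_id_le: "\<bar>psi n - real n\<bar> \<le> 4 * real n"
  using psi_le[of n] psi_nonneg[of n] by linarith

text \<open>
  Partial summation; the boundary term vanishes in the limit because of \<open>psi_le\<close>.
\<close>

lemma mangoldt_series_minus_zeta_series:
  assumes s: "Re s > 1"
  shows "(\<lambda>n. of_real (psi (Suc n) - real (Suc n)) * (of_nat (Suc n) powr (-s) - of_nat (Suc (Suc n)) powr (-s)))
    sums (mangoldt_series s - zeta_series s)"
proof -
  have "(\<lambda>n. mangoldt (Suc n) * of_nat (Suc n) powr (-s) - of_nat (Suc n) powr (-s))
      sums (mangoldt_series s - zeta_series s)"
    by (intro sums_diff summable_sums summable_norm_cancel[OF summable_norm_mangoldt_series[OF s]]
        summable_norm_cancel[OF summable_norm_zeta_series[OF s]])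
  hence "(\<lambda>N. \<Sum>n<N. (mangoldt (Suc n) - 1) * of_nat (Suc n) powr (-s))
      \<longlonglongrightarrow> mangoldt_series s - zeta_series s"
    by (simp only: sums_def left_diff_distrib mult_1)
  moreover have "(\<lambda>N. of_real (psi N - real N) * of_nat (Suc N) powr (-s)) \<longlonglongrightarrow> 0"
  proof (rule Lim_null_comparison)
    have "norm (of_real (psi N - real N) * of_nat (Suc N) powr (-s)) \<le> 4 * real N * real (Suc N) powr (- Re s)" for N
      unfolding norm_mult norm_of_real norm_of_nat_Suc_powr uminus_complex.simps
      by (intro mult_right_mono abs_psi_minus_id_le) simp
    thus "\<forall>\<^sub>F N in sequentially. norm (of_real (psi N - real N) * of_nat (Suc N) powr (-s)) \<le> 4 * real N * real (Suc N) powr (- Re s)"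
      by (intro always_eventually allI)
    show "(\<lambda>N. 4 * real N * real (Suc N) powr (- Re s)) \<longlonglongrightarrow> 0"
      using s by real_asymp
  qed
  ultimately have "(\<lambda>N. (\<Sum>n<N. (mangoldt (Suc n) - 1) * of_nat (Suc n) powr (-s))
       - of_real (psi N - real N) * of_nat (Suc N) powr (-s)) \<longlonglongrightarrow> (mangoldt_series s - zeta_series s) - 0"
    by (rule tendsto_diff)
  thus ?thesis unfolding psi_minus_id_partial_summation add_diff_cancel_right' sums_def diff_0_right .
qed

text \<open>
  The coefficients are \<open>a n = \<beta> n / m\<close> with \<open>\<beta> n = \<psi> m - m\<close> and \<open>m = Suc n\<close>. For \<open>Re s > 1\<close>
  the definition of \<open>zeta_term\<close> gives \<open>s * \<Sum> a n * m powr (-s) = F s + G (s + 1)\<close>: here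
  \<open>F s = \<Sum> \<beta> n * (m powr (-s) - (m + 1) powr (-s))\<close> is the difference of the series for
  \<open>- \<zeta>' / \<zeta>\<close> and \<open>\<zeta>\<close>, whose poles at \<open>1\<close> cancel, and \<open>G\<close> is a \<open>zeta_term\<close> series with
  coefficients of linear growth. Both extend holomorphically beyond \<open>Re s \<ge> 1\<close>, and Newman's theorem applies
  with \<open>z = s - 1\<close>.
\<close>

lemma summable_psi_minus_id: "summable (\<lambda>n. (psi (Suc n) - real (Suc n)) / (real (Suc n))\<^sup>2)"
proof -
  define \<beta> where "\<beta> = (\<lambda>n. complex_of_real (psi (Suc n) - real (Suc n)))"
  define a where "a = (\<lambda>n. \<beta> n / of_nat (Suc n))"
  have \<beta>: "norm (\<beta> n) \<le> 4 * real (Suc n) powr 1" for n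
    using abs_psi_minus_id_le[of "Suc n"] by (simp add: \<beta>_def del: of_nat_Suc of_real_diff)
  have a: "norm (a n) \<le> 4" for n
    using abs_psi_minus_id_le[of "Suc n"]
    by (simp add: a_def \<beta>_def norm_divide divide_le_eq del: of_nat_Suc of_real_diff)
  define V where "V = {s. Re s > 0} \<inter> zeta_reg -` (- {0})"
  have V: "open V"
    unfolding V_def by (intro continuous_open_preimage holomorphic_on_imp_continuous_on
        holomorphic_zeta_reg open_halfspace_Re_gt) auto
  have hV: "zeta_reg holomorphic_on V"
    using holomorphic_zeta_reg by (rule holomorphic_on_subset) (auto simp: V_def)
  \<comment> \<open>The pole of \<open>\<zeta>\<close> at \<open>1\<close> has cancelled, up to the removable singularity of this quotient.\<close>
  define q where "q = (\<lambda>s. if s = 1 then deriv zeta_reg 1 else (zeta_reg s - zeta_reg 1) / (s - 1))"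
  define F where "F = (\<lambda>s. - (deriv zeta_reg s / zeta_reg s) - q s)"
  have hF: "F holomorphic_on V"
    unfolding F_def q_def
    by (intro holomorphic_intros holomorphic_deriv hV V pole_lemma_open) (auto simp: V_def)
  have F: "F s = mangoldt_series s - zeta_series s" if s: "Re s > 1" for s
  proof -
    define x where "x = s - 1"
    have x: "x \<noteq> 0" "s \<noteq> 1" using s by (auto simp: x_def)
    have Z: "zeta_reg s \<noteq> 0" using s by (intro zeta_reg_nonzero) simp
    have "zeta_reg s * mangoldt_series s = zeta_reg s / x - deriv zeta_reg s"
      unfolding x_def by (rule mangoldt_series_eq[OF s])
    hence L: "mangoldt_series s = 1 / x - deriv zeta_reg s / zeta_reg s"
      using Z x by (simp add: field_simps)
    have "zeta_series s = zeta_reg s / x"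
      unfolding zeta_reg_eq[OF s] x_def using x(1)[unfolded x_def] by simp
    with L show ?thesis
      using x by (simp add: F_def q_def diff_divide_distrib flip: x_def)
  qed
  define G where "G = (\<lambda>s. \<Sum>n. \<beta> n * zeta_term n s)"
  have hG: "G holomorphic_on {s. Re s > 1}"
    unfolding G_def by (rule holomorphic_zeta_term_series(1)[OF \<beta>]) simp
  define S where "S = (\<lambda>z. 1 + z) -` V"
  have S: "open S" unfolding S_def by (intro open_vimage V continuous_intros)
  have hS: "z \<in> S" if "Re z \<ge> 0" for z
    using that zeta_reg_nonzero[of "1 + z"] by (auto simp: S_def V_def)
  define f where "f = (\<lambda>z. (F (1 + z) + G (2 + z)) / (1 + z))"
  have "F \<circ> (\<lambda>z. 1 + z) holomorphic_on S"
    by (rule holomorphic_on_compose_gen[OF _ hF]) (auto intro!: holomorphic_intros simp: S_def)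
  moreover have "G \<circ> (\<lambda>z. 2 + z) holomorphic_on S"
    by (rule holomorphic_on_compose_gen[OF _ hG]) (auto intro!: holomorphic_intros simp: S_def V_def)
  moreover have "1 + z \<noteq> 0" if "z \<in> S" for z
  proof
    assume "1 + z = 0"
    hence "Re (1 + z) = 0" by simp
    thus False using that by (simp add: S_def V_def)
  qed
  ultimately have hf: "f holomorphic_on S"
    unfolding f_def o_def by (intro holomorphic_intros)
  have "(\<lambda>n. a n * of_nat (Suc n) powr (-1 - z)) sums f z" if z: "Re z > 0" for z
  proof -
    define s where "s = 1 + z"
    have s: "Re s > 1" using z by (simp add: s_def)
    have s0: "s \<noteq> 0" using s by auto
    have "summable (\<lambda>n. \<beta> n * zeta_term n (s + 1))"
      by (rule holomorphic_zeta_term_series(2)[OF \<beta>]) (use s in auto)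
    hence "(\<lambda>n. \<beta> n * zeta_term n (s + 1)) sums G (s + 1)" unfolding G_def by (rule summable_sums)
    from sums_add[OF mangoldt_series_minus_zeta_series[OF s] this]
    have "(\<lambda>n. \<beta> n * (of_nat (Suc n) powr (-s) - of_nat (Suc (Suc n)) powr (-s)) + \<beta> n * zeta_term n (s + 1))
        sums (F s + G (s + 1))"
      unfolding F[OF s] \<beta>_def .
    moreover have "\<beta> n * (of_nat (Suc n) powr (-s) - of_nat (Suc (Suc n)) powr (-s)) + \<beta> n * zeta_term n (s + 1)
        = s * (a n * of_nat (Suc n) powr (-s))" for n
    proof -
      have "of_nat (Suc n) powr (-(s + 1)) = of_nat (Suc n) powr (-s) / of_nat (Suc n)"
        using powr_diff[of "of_nat (Suc n)" "-s" 1] by (simp del: of_nat_Suc)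
      hence "of_nat (Suc n) powr (-s) - of_nat (Suc (Suc n)) powr (-s) + zeta_term n (s + 1)
          = s * (of_nat (Suc n) powr (-s) / of_nat (Suc n))"
        by (simp add: zeta_term_def del: of_nat_Suc)
      from arg_cong[OF this, of "\<lambda>x. \<beta> n * x"] show ?thesis
        unfolding a_def by (simp add: distrib_left mult_ac del: of_nat_Suc)
    qed
    ultimately have "(\<lambda>n. s * (a n * of_nat (Suc n) powr (-s))) sums (F s + G (s + 1))" by (simp only:)
    from sums_divide[OF this, of s] have "(\<lambda>n. a n * of_nat (Suc n) powr (-s)) sums ((F s + G (s + 1)) / s)"
      using s0 by simp
    moreover have "s + 1 = 2 + z" "-s = -1 - z" by (simp_all add: s_def)
    ultimately show ?thesis by (simp only: f_def s_def)
  qed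
  from newman_ingham[OF a S hS hf this]
  have "(\<lambda>n. a n / of_nat (Suc n)) sums f 0" by simp
  hence "summable (\<lambda>n. Re (a n / of_nat (Suc n)))" by (intro summable_Re) (rule sums_summable)
  moreover have "Re (a n / of_nat (Suc n)) = (psi (Suc n) - real (Suc n)) / (real (Suc n))\<^sup>2" for n
  proof -
    have "a n / of_nat (Suc n) = complex_of_real ((psi (Suc n) - real (Suc n)) / real (Suc n) / real (Suc n))"
      unfolding a_def \<beta>_def by (simp only: of_real_divide of_real_of_nat_eq)
    thus ?thesis by (simp only: Re_complex_of_real divide_divide_eq_left power2_eq_square)
  qed
  ultimately show ?thesis by (simp only:)
qed

theorem psi_asymptotics: "(\<lambda>n. psi n / real n) \<longlonglongrightarrow> 1"
  by (rule tendsto_one_if_mono_summable[OF mono_psi summable_psi_minus_id])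

section \<open>Asymptotics of the sum of the primes\<close>

definition theta :: "nat \<Rightarrow> real" where
  "theta n = (\<Sum>p | prime p \<and> p \<le> n. ln (real p))"

lemma psi_minus_theta: "psi n - theta n = (\<Sum>k | k \<le> n \<and> primepow k \<and> \<not> prime k. mangoldt k)"
proof -
  have "psi n = (\<Sum>k | k \<le> n \<and> primepow k. mangoldt k)"
    unfolding psi_def by (intro sum.mono_neutral_right) (auto simp: mangoldt_def)
  also have "{k. k \<le> n \<and> primepow k} = {p. prime p \<and> p \<le> n} \<union> {k. k \<le> n \<and> primepow k \<and> \<not> prime k}"
    by (auto simp: primepow_prime)
  also have "(\<Sum>k\<in>\<dots>. mangoldt k) = (\<Sum>k | prime k \<and> k \<le> n. mangoldt k) + (\<Sum>k | k \<le> n \<and> primepow k \<and> \<not> prime k. mangoldt k :: real)"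
    by (intro sum.union_disjoint) auto
  also have "(\<Sum>k | prime k \<and> k \<le> n. mangoldt k) = theta n"
    unfolding theta_def by (intro sum.cong) auto
  finally show ?thesis by simp
qed

lemma theta_le_psi: "theta n \<le> psi n"
proof -
  have "0 \<le> psi n - theta n" unfolding psi_minus_theta by (intro sum_nonneg mangoldt_nonneg)
  thus ?thesis by simp
qed

text \<open>
  A prime power \<open>p ^ j \<le> n\<close> with \<open>j \<ge> 2\<close> has \<open>p \<le> sqrt n\<close> and \<open>j \<le> log 2 n\<close>, so there are few of
  them.
\<close>

lemma psi_minus_theta_le:
  assumes n: "n > 0"
  shows "psi n - theta n \<le> sqrt (real n) * log 2 (real n) * ln (real n)"
proof -
  define A where "A = {k. k \<le> n \<and> primepow k \<and> \<not> prime k}"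
  define B where "B = {1..nat \<lfloor>sqrt (real n)\<rfloor>} \<times> {1..nat \<lfloor>log 2 (real n)\<rfloor>}"
  have sub: "A \<subseteq> (\<lambda>(p, j). p ^ j) ` B"
  proof
    fix k assume k: "k \<in> A"
    then obtain p j where pj: "prime p" "j > 0" "k = p ^ j" by (auto simp: A_def primepow_def)
    have j: "j \<ge> 2" using k pj by (cases "j = 1") (auto simp: A_def)
    have kn: "p ^ j \<le> n" using k pj by (simp add: A_def)
    have p2: "p \<ge> 2" using pj(1) by (rule prime_ge_2_nat)
    have "p ^ 2 \<le> p ^ j" using j p2 by (intro power_increasing) auto
    hence "p ^ 2 \<le> n" using kn by simp
    hence "real p ^ 2 \<le> real n" by (simp flip: of_nat_power)
    hence "real p \<le> sqrt (real n)" by (rule real_le_rsqrt)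
    moreover have "2 ^ j \<le> p ^ j" using p2 by (intro power_mono) auto
    hence "2 ^ j \<le> n" using kn by simp
    hence "2 ^ j \<le> real n" by (metis of_nat_le_iff of_nat_numeral of_nat_power)
    hence "real j \<le> log 2 (real n)" using n by (simp add: le_log_iff powr_realpow)
    ultimately have "(p, j) \<in> B" using p2 j by (auto simp: B_def le_nat_floor)
    thus "k \<in> (\<lambda>(p, j). p ^ j) ` B" using pj by force
  qed
  have "card A \<le> card B"
    using card_mono[OF _ sub] card_image_le[of B "\<lambda>(p, j). p ^ j"] by (simp add: B_def)
  also have "card B = nat \<lfloor>sqrt (real n)\<rfloor> * nat \<lfloor>log 2 (real n)\<rfloor>"
    by (simp add: B_def card_cartesian_product)
  finally have "real (card A) \<le> real (nat \<lfloor>sqrt (real n)\<rfloor>) * real (nat \<lfloor>log 2 (real n)\<rfloor>)"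
    by (simp only: of_nat_mult[symmetric] of_nat_le_iff)
  also have "\<dots> \<le> sqrt (real n) * log 2 (real n)"
    using n by (intro mult_mono of_nat_floor) auto
  finally have card: "real (card A) \<le> sqrt (real n) * log 2 (real n)" .
  have "psi n - theta n = (\<Sum>k\<in>A. mangoldt k)" unfolding A_def by (rule psi_minus_theta)
  also have "\<dots> \<le> (\<Sum>k\<in>A. ln (real n))"
  proof (rule sum_mono)
    fix k assume "k \<in> A"
    hence "0 < k" "k \<le> n" by (auto simp: A_def dest: primepow_gt_0_nat)
    hence "mangoldt k \<le> ln (real k)" "ln (real k) \<le> ln (real n)" by (auto intro: mangoldt_le ln_mono)
    thus "mangoldt k \<le> ln (real n)" by (rule order_trans)
  qed
  also have "\<dots> = real (card A) * ln (real n)" by simp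
  also have "\<dots> \<le> sqrt (real n) * log 2 (real n) * ln (real n)"
    using n by (intro mult_right_mono card) auto
  finally show ?thesis .
qed

lemma theta_asymptotics: "(\<lambda>n. theta n / real n) \<longlonglongrightarrow> 1"
proof (rule tendsto_sandwich)
  show "\<forall>\<^sub>F n in sequentially. theta n / real n \<le> psi n / real n"
    by (intro always_eventually allI divide_right_mono theta_le_psi) auto
  show "\<forall>\<^sub>F n in sequentially. psi n / real n - sqrt (real n) * log 2 (real n) * ln (real n) / real n \<le> theta n / real n"
    using eventually_gt_at_top[of 0]
  proof eventually_elim
    case (elim n)
    have "psi n - sqrt (real n) * log 2 (real n) * ln (real n) \<le> theta n"
      using psi_minus_theta_le[OF elim] by simp
    thus ?case unfolding diff_divide_distrib[symmetric] by (rule divide_right_mono) simp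
  qed
  have "(\<lambda>n. sqrt (real n) * log 2 (real n) * ln (real n) / real n) \<longlonglongrightarrow> 0" by real_asymp
  from tendsto_diff[OF psi_asymptotics this]
  show "(\<lambda>n. psi n / real n - sqrt (real n) * log 2 (real n) * ln (real n) / real n) \<longlonglongrightarrow> 1" by simp
qed (rule psi_asymptotics)

lemma sum_over_square_tendsto_0:
  fixes e :: "nat \<Rightarrow> real"
  assumes "(\<lambda>n. e n / real n) \<longlonglongrightarrow> 0"
  shows "(\<lambda>N. (\<Sum>n<N. e n) / (real N)\<^sup>2) \<longlonglongrightarrow> 0"
proof (rule tendstoI)
  fix \<epsilon> :: real assume \<epsilon>: "\<epsilon> > 0"
  have "\<forall>\<^sub>F n in sequentially. \<bar>e n / real n\<bar> < \<epsilon> / 2"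
    using tendstoD[OF assms, of "\<epsilon> / 2"] \<epsilon> by (simp add: dist_real_def)
  then obtain M where M: "\<And>n. n \<ge> M \<Longrightarrow> \<bar>e n / real n\<bar> < \<epsilon> / 2"
    by (auto simp: eventually_at_top_linorder)
  define K where "K = (\<Sum>n<Suc M. \<bar>e n\<bar>)"
  have bound: "\<bar>\<Sum>n<N. e n\<bar> \<le> K + \<epsilon> / 2 * (real N)\<^sup>2" for N
  proof -
    have "\<bar>e n\<bar> \<le> (if n < Suc M then \<bar>e n\<bar> else 0) + \<epsilon> / 2 * real N" if "n < N" for n
    proof (cases "n < Suc M")
      case True thus ?thesis using \<epsilon> by simp
    next
      case False
      hence "\<bar>e n\<bar> < \<epsilon> / 2 * real n" using M[of n] by (simp add: divide_less_eq)
      also have "\<dots> \<le> \<epsilon> / 2 * real N" using that \<epsilon> by (intro mult_left_mono) auto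
      finally show ?thesis using False by simp
    qed
    hence "(\<Sum>n<N. \<bar>e n\<bar>) \<le> (\<Sum>n<N. (if n < Suc M then \<bar>e n\<bar> else 0) + \<epsilon> / 2 * real N)"
      by (intro sum_mono) auto
    also have "\<dots> = (\<Sum>n<N. if n < Suc M then \<bar>e n\<bar> else 0) + \<epsilon> / 2 * (real N)\<^sup>2"
      by (simp add: sum.distrib power2_eq_square)
    also have "(\<Sum>n<N. if n < Suc M then \<bar>e n\<bar> else 0) = (\<Sum>n\<in>{n\<in>{..<N}. n < Suc M}. \<bar>e n\<bar>)"
      by (rule sum.inter_filter[symmetric]) simp
    also have "\<dots> \<le> K" unfolding K_def by (rule sum_mono2) auto
    finally show ?thesis using sum_abs[of e "{..<N}"] by linarith
  qed
  have "(\<lambda>N. K / (real N)\<^sup>2) \<longlonglongrightarrow> 0" by real_asymp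
  hence "\<forall>\<^sub>F N in sequentially. K / (real N)\<^sup>2 < \<epsilon> / 2" using \<epsilon> by (intro order_tendstoD(2)) auto
  thus "\<forall>\<^sub>F N in sequentially. dist ((\<Sum>n<N. e n) / (real N)\<^sup>2) 0 < \<epsilon>"
    using eventually_gt_at_top[of 0]
  proof eventually_elim
    case (elim N)
    have "\<bar>\<Sum>n<N. e n\<bar> / (real N)\<^sup>2 \<le> (K + \<epsilon> / 2 * (real N)\<^sup>2) / (real N)\<^sup>2"
      by (intro divide_right_mono bound) auto
    also have "\<dots> = K / (real N)\<^sup>2 + \<epsilon> / 2" using elim(2) by (simp add: add_divide_distrib)
    also have "\<dots> < \<epsilon>" using elim(1) by linarith
    finally show ?case by (simp add: dist_real_def)
  qed
qed

text \<open>
  Weighting the primes by \<open>p * ln p\<close> gives a sum that can be expressed exactly by \<open>theta\<close>.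
\<close>

definition prime_log_sum :: "nat \<Rightarrow> real" where
  "prime_log_sum n = (\<Sum>p | prime p \<and> p \<le> n. real p * ln (real p))"

lemma primes_le_Suc: "{p. prime p \<and> p \<le> Suc n} = (if prime (Suc n) then insert (Suc n) {p. prime p \<and> p \<le> n} else {p. prime p \<and> p \<le> n})"
  by (auto simp: le_Suc_eq)

lemma prime_log_sum_eq: "prime_log_sum n = real n * theta n - (\<Sum>k<n. theta k)"
proof (induction n)
  case 0
  show ?case by (simp add: prime_log_sum_def theta_def)
next
  case (Suc n)
  have fin: "finite {p. prime p \<and> p \<le> n}" "Suc n \<notin> {p. prime p \<and> p \<le> n}" by auto
  have t: "theta (Suc n) = theta n + (if prime (Suc n) then ln (real (Suc n)) else 0)"
    unfolding theta_def primes_le_Suc using fin by (simp del: of_nat_Suc)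
  have "prime_log_sum (Suc n) = prime_log_sum n + real (Suc n) * (if prime (Suc n) then ln (real (Suc n)) else 0)"
    unfolding prime_log_sum_def primes_le_Suc using fin by (simp del: of_nat_Suc)
  also have "\<dots> = prime_log_sum n + real (Suc n) * (theta (Suc n) - theta n)" by (simp only: t) simp
  also have "\<dots> = real (Suc n) * theta (Suc n) - (\<Sum>k<Suc n. theta k)"
    unfolding Suc.IH by (simp add: algebra_simps)
  finally show ?case .
qed

lemma prime_log_sum_asymptotics: "(\<lambda>n. prime_log_sum n / (real n)\<^sup>2) \<longlonglongrightarrow> 1 / 2"
proof -
  have sumid: "(\<Sum>k<n. real k) = real n * (real n - 1) / 2" for n
    by (induction n) (auto simp: field_simps)
  have "(\<lambda>n. (theta n - real n) / real n) \<longlonglongrightarrow> 0"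
  proof (rule Lim_transform_eventually)
    show "(\<lambda>n. theta n / real n - 1) \<longlonglongrightarrow> 0"
      using tendsto_diff[OF theta_asymptotics tendsto_const[of 1]] by simp
    show "\<forall>\<^sub>F n in sequentially. theta n / real n - 1 = (theta n - real n) / real n"
      using eventually_gt_at_top[of 0] by eventually_elim (simp add: diff_divide_distrib)
  qed
  note e = sum_over_square_tendsto_0[OF this]
  have "(\<lambda>n. real n * (real n - 1) / 2 / (real n)\<^sup>2) \<longlonglongrightarrow> 1 / 2" by real_asymp
  from tendsto_diff[OF tendsto_diff[OF theta_asymptotics e] this]
  have "(\<lambda>n. theta n / real n - (\<Sum>k<n. theta k - real k) / (real n)\<^sup>2 - real n * (real n - 1) / 2 / (real n)\<^sup>2) \<longlonglongrightarrow> 1 / 2"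
    by simp
  moreover have "\<forall>\<^sub>F n in sequentially. theta n / real n - (\<Sum>k<n. theta k - real k) / (real n)\<^sup>2 - real n * (real n - 1) / 2 / (real n)\<^sup>2
      = prime_log_sum n / (real n)\<^sup>2"
    using eventually_gt_at_top[of 0]
  proof eventually_elim
    case (elim n)
    have "theta n / real n = real n * theta n / (real n)\<^sup>2" using elim by (simp add: power2_eq_square)
    hence "theta n / real n - (\<Sum>k<n. theta k - real k) / (real n)\<^sup>2 - real n * (real n - 1) / 2 / (real n)\<^sup>2
       = (real n * theta n - (\<Sum>k<n. theta k - real k) - real n * (real n - 1) / 2) / (real n)\<^sup>2"
      by (simp only: diff_divide_distrib)
    also have "real n * theta n - (\<Sum>k<n. theta k - real k) - real n * (real n - 1) / 2 = prime_log_sum n"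
      unfolding prime_log_sum_eq sum_subtractf sumid by simp
    finally show ?case .
  qed
  ultimately show ?thesis by (rule Lim_transform_eventually)
qed

lemma finite_primes_le: "finite {p::nat. prime p \<and> real p \<le> x}"
  by (rule finite_subset[of _ "{..nat \<lfloor>x\<rfloor>}"]) (auto simp: le_nat_floor)

lemma prime_sum_nonneg: "prime_sum x \<ge> 0"
  unfolding prime_sum_def by (intro sum_nonneg) auto

lemma prime_sum_le_square:
  assumes x: "x \<ge> 0"
  shows "prime_sum x \<le> x\<^sup>2"
proof -
  have "prime_sum x \<le> (\<Sum>p\<in>{p::nat. prime p \<and> real p \<le> x}. x)"
    unfolding prime_sum_def by (intro sum_mono) auto
  also have "\<dots> = real (card {p::nat. prime p \<and> real p \<le> x}) * x" by simp
  also have "\<dots> \<le> x * x"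
  proof (intro mult_right_mono x)
    have "card {p::nat. prime p \<and> real p \<le> x} \<le> card {1..nat \<lfloor>x\<rfloor>}"
      by (intro card_mono) (auto simp: le_nat_floor Suc_le_eq prime_gt_0_nat)
    hence "real (card {p::nat. prime p \<and> real p \<le> x}) \<le> real (nat \<lfloor>x\<rfloor>)" by simp
    also have "\<dots> \<le> x" using x by (rule of_nat_floor)
    finally show "real (card {p::nat. prime p \<and> real p \<le> x}) \<le> x" .
  qed
  finally show ?thesis by (simp add: power2_eq_square)
qed

text \<open>
  Replacing each factor \<open>ln p\<close> by \<open>ln n\<close> bounds \<open>prime_log_sum n\<close> by \<open>prime_sum n * ln n\<close>. Conversely,
  the primes up to \<open>y = n / ln n\<close> contribute at most \<open>y\<^sup>2\<close> to \<open>prime_sum n\<close>, which is negligible,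
  and the others satisfy \<open>ln p \<ge> ln n - ln (ln n)\<close>.
\<close>

lemma prime_sum_nat_asymptotics: "(\<lambda>n. prime_sum (real n) * ln (real n) / (real n)\<^sup>2) \<longlonglongrightarrow> 1 / 2"
proof (rule tendsto_sandwich)
  let ?W = "\<lambda>n. prime_log_sum n / (real n)\<^sup>2"
  show "?W \<longlonglongrightarrow> 1 / 2" by (rule prime_log_sum_asymptotics)
  have "(\<lambda>n. ln (real n) / (ln (real n) - ln (ln (real n)))) \<longlonglongrightarrow> 1" by real_asymp
  moreover have "(\<lambda>n. 1 / ln (real n)) \<longlonglongrightarrow> 0" by real_asymp
  ultimately show "(\<lambda>n. 1 / ln (real n) + ?W n * (ln (real n) / (ln (real n) - ln (ln (real n))))) \<longlonglongrightarrow> 1 / 2"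
    using tendsto_add[OF _ tendsto_mult[OF prime_log_sum_asymptotics]] by fastforce
  show "\<forall>\<^sub>F n in sequentially. ?W n \<le> prime_sum (real n) * ln (real n) / (real n)\<^sup>2"
    using eventually_gt_at_top[of 0]
  proof eventually_elim
    case (elim n)
    have "prime_log_sum n \<le> (\<Sum>p | prime p \<and> p \<le> n. real p * ln (real n))"
      unfolding prime_log_sum_def
      by (intro sum_mono mult_left_mono ln_mono) (auto simp: prime_gt_0_nat)
    also have "\<dots> = prime_sum (real n) * ln (real n)"
      by (simp add: prime_sum_def sum_distrib_right)
    finally show ?case by (rule divide_right_mono) simp
  qed
  have "\<forall>\<^sub>F n::nat in sequentially. ln (real n) > 1" "\<forall>\<^sub>F n::nat in sequentially. ln (real n) - ln (ln (real n)) > 0"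
    by real_asymp+
  thus "\<forall>\<^sub>F n in sequentially. prime_sum (real n) * ln (real n) / (real n)\<^sup>2
      \<le> 1 / ln (real n) + ?W n * (ln (real n) / (ln (real n) - ln (ln (real n))))"
    using eventually_gt_at_top[of 0]
  proof eventually_elim
    case (elim n)
    define l where "l = ln (real n)"
    define y where "y = real n / l"
    have l: "l > 1" "l - ln l > 0" using elim by (auto simp: l_def)
    have n: "real n > 0" using elim by simp
    have y: "y > 0" using l n by (simp add: y_def)
    have lny: "ln y = l - ln l" using l n by (simp add: y_def ln_div l_def)
    have yn: "y \<le> real n" using l n by (simp add: y_def field_simps)
    have split: "{p::nat. prime p \<and> real p \<le> real n} = {p. prime p \<and> real p \<le> y} \<union> {p. prime p \<and> p \<le> n \<and> y < real p}"
      using yn by auto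
    have "prime_sum (real n) = prime_sum y + (\<Sum>p | prime p \<and> p \<le> n \<and> y < real p. real p)"
      unfolding prime_sum_def split by (intro sum.union_disjoint finite_primes_le) auto
    also have "\<dots> \<le> y\<^sup>2 + prime_log_sum n / (l - ln l)"
    proof (intro add_mono prime_sum_le_square)
      have "(\<Sum>p | prime p \<and> p \<le> n \<and> y < real p. real p) \<le> (\<Sum>p | prime p \<and> p \<le> n \<and> y < real p. real p * ln (real p) / (l - ln l))"
      proof (intro sum_mono)
        fix p assume p: "p \<in> {p. prime p \<and> p \<le> n \<and> y < real p}"
        have "l - ln l \<le> ln (real p)" unfolding lny[symmetric] using p y by (intro ln_mono) auto
        hence "real p * (l - ln l) \<le> real p * ln (real p)" by (intro mult_left_mono) auto
        thus "real p \<le> real p * ln (real p) / (l - ln l)" using l by (simp add: pos_le_divide_eq)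
      qed
      also have "\<dots> \<le> (\<Sum>p | prime p \<and> p \<le> n. real p * ln (real p) / (l - ln l))"
      proof (intro sum_mono2)
        fix p assume "p \<in> {p. prime p \<and> p \<le> n} - {p. prime p \<and> p \<le> n \<and> y < real p}"
        hence "real p \<ge> 1" using prime_ge_1_nat[of p] by auto
        thus "0 \<le> real p * ln (real p) / (l - ln l)" using l by (intro divide_nonneg_pos mult_nonneg_nonneg ln_ge_zero) auto
      qed auto
      also have "\<dots> = prime_log_sum n / (l - ln l)" by (simp add: prime_log_sum_def sum_divide_distrib)
      finally show "(\<Sum>p | prime p \<and> p \<le> n \<and> y < real p. real p) \<le> prime_log_sum n / (l - ln l)" .
    qed (use y in simp)
    finally have "prime_sum (real n) * l / (real n)\<^sup>2 \<le> (y\<^sup>2 + prime_log_sum n / (l - ln l)) * l / (real n)\<^sup>2"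
      using l by (intro divide_right_mono mult_right_mono) auto
    also have "\<dots> = y\<^sup>2 * l / (real n)\<^sup>2 + prime_log_sum n / (real n)\<^sup>2 * (l / (l - ln l))"
      by (simp add: distrib_right add_divide_distrib)
    also have "y\<^sup>2 * l / (real n)\<^sup>2 = 1 / l" using l n by (simp add: y_def power2_eq_square field_simps)
    finally show ?case by (simp add: l_def)
  qed
qed

lemma prime_sum_floor:
  assumes "x \<ge> 0"
  shows "prime_sum x = prime_sum (real (nat \<lfloor>x\<rfloor>))"
proof -
  have "real p \<le> x \<longleftrightarrow> real p \<le> real (nat \<lfloor>x\<rfloor>)" for p
  proof
    show "real p \<le> x" if "real p \<le> real (nat \<lfloor>x\<rfloor>)" using that of_nat_floor[OF assms] by (rule order_trans)
    show "real p \<le> real (nat \<lfloor>x\<rfloor>)" if "real p \<le> x" using le_nat_floor[OF that] by (simp only: of_nat_le_iff)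
  qed
  thus ?thesis unfolding prime_sum_def by (simp only:)
qed

theorem prime_sum_asymptotics: "((\<lambda>x. prime_sum x * ln x / x\<^sup>2) \<longlongrightarrow> 1 / 2) at_top"
proof -
  have fl: "filterlim (\<lambda>x::real. nat \<lfloor>x\<rfloor>) sequentially at_top"
    by (intro filterlim_compose[OF filterlim_nat_sequentially] filterlim_floor_sequentially)
  have "((\<lambda>x::real. (ln x / ln (real (nat \<lfloor>x\<rfloor>))) * (real (nat \<lfloor>x\<rfloor>) / x)\<^sup>2) \<longlongrightarrow> 1) at_top"
    by real_asymp
  from tendsto_mult[OF filterlim_compose[OF prime_sum_nat_asymptotics fl] this]
  have lim: "((\<lambda>x. prime_sum (real (nat \<lfloor>x\<rfloor>)) * ln (real (nat \<lfloor>x\<rfloor>)) / (real (nat \<lfloor>x\<rfloor>))\<^sup>2 *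
     ((ln x / ln (real (nat \<lfloor>x\<rfloor>))) * (real (nat \<lfloor>x\<rfloor>) / x)\<^sup>2)) \<longlongrightarrow> 1 / 2) at_top" by simp
  show ?thesis
  proof (rule Lim_transform_eventually[OF lim])
    show "\<forall>\<^sub>F x in at_top. prime_sum (real (nat \<lfloor>x\<rfloor>)) * ln (real (nat \<lfloor>x\<rfloor>)) / (real (nat \<lfloor>x\<rfloor>))\<^sup>2 *
     ((ln x / ln (real (nat \<lfloor>x\<rfloor>))) * (real (nat \<lfloor>x\<rfloor>) / x)\<^sup>2) = prime_sum x * ln x / x\<^sup>2"
      using eventually_ge_at_top[of 2]
    proof eventually_elim
      case (elim x)
      define m where "m = real (nat \<lfloor>x\<rfloor>)"
      have "m \<ge> 2" using elim le_nat_floor[of 2 x] by (simp add: m_def)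
      hence "ln m \<noteq> 0" "m \<noteq> 0" by auto
      thus ?case using elim prime_sum_floor[of x] unfolding m_def[symmetric]
        by (simp add: power2_eq_square)
    qed
  qed
qed

section \<open>The sum of the prime factors\<close>

text \<open>
  Both sides add up \<open>p\<close> over the pairs \<open>(m, p)\<close> with \<open>m * p \<le> x\<close>, grouped by \<open>m * p\<close> and by \<open>m\<close>.
\<close>

lemma sum_prime_factors_eq_sum_prime_sum:
  fixes x :: real
  assumes x: "x \<ge> 0"
  shows "(\<Sum>n | 1 \<le> n \<and> real n \<le> x. \<Sum>p\<in>prime_factors n. real p) = (\<Sum>m | 1 \<le> m \<and> real m \<le> x. prime_sum (x / real m))"
proof -
  let ?N = "{n::nat. 1 \<le> n \<and> real n \<le> x}"
  have fin: "finite ?N" by (rule finite_subset[of _ "{..nat \<lfloor>x\<rfloor>}"]) (auto simp: le_nat_floor)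
  have "(\<Sum>n\<in>?N. \<Sum>p\<in>prime_factors n. real p) = (\<Sum>(n,p)\<in>Sigma ?N prime_factors. real p)"
    using fin by (intro sum.Sigma) auto
  also have "\<dots> = (\<Sum>(m,p)\<in>Sigma ?N (\<lambda>m. {p. prime p \<and> real p \<le> x / real m}). real p)"
  proof (rule sum.reindex_bij_witness[where i = "\<lambda>(m,p). (m * p, p)" and j = "\<lambda>(n,p). (n div p, p)"], goal_cases)
    case (1 a)
    thus ?case by (auto simp: in_prime_factors_iff)
  next
    case (2 a)
    then obtain n p where a: "a = (n, p)" "1 \<le> n" "real n \<le> x" "prime p" "p dvd n"
      by (auto simp: in_prime_factors_iff)
    have "n div p * p = n" using a by simp
    hence e: "real (n div p) * real p = real n" by (simp only: of_nat_mult[symmetric])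
    have m: "1 \<le> n div p" using a by (metis dvd_div_eq_0_iff less_one not_less)
    have "real (n div p) \<le> x" by (rule order_trans[OF _ a(3)]) simp
    moreover have "real p \<le> x / real (n div p)"
      using e a m by (simp add: pos_le_divide_eq mult.commute)
    ultimately show ?case using a m by auto
  next
    case (3 b)
    thus ?case by (auto dest: prime_gt_0_nat)
  next
    case (4 b)
    then obtain m p where b: "b = (m, p)" "1 \<le> m" "prime p" "real p \<le> x / real m" by auto
    have "real (m * p) \<le> x" using b by (simp add: pos_le_divide_eq mult.commute)
    moreover have "1 \<le> m * p" using b prime_gt_0_nat[of p] by simp
    ultimately show ?case using b by (auto simp: in_prime_factors_iff)
  qed auto
  also have "\<dots> = (\<Sum>m\<in>?N. \<Sum>p | prime p \<and> real p \<le> x / real m. real p)"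
    using fin by (intro sum.Sigma[symmetric]) (auto intro: finite_primes_le)
  finally show ?thesis by (simp only: prime_sum_def)
qed

lemma prime_sum_less_one: "x < 1 \<Longrightarrow> prime_sum x = 0"
  unfolding prime_sum_def by (intro sum.neutral) (auto dest: prime_ge_1_nat)

lemma sum_prime_factors_eq_suminf:
  fixes x :: real
  assumes x: "x \<ge> 0"
  shows "(\<Sum>n | 1 \<le> n \<and> real n \<le> x. \<Sum>p\<in>prime_factors n. real p) = (\<Sum>k. prime_sum (x / real (Suc k)))"
proof -
  have "(\<Sum>k. prime_sum (x / real (Suc k))) = (\<Sum>k | real (Suc k) \<le> x. prime_sum (x / real (Suc k)))"
  proof (rule suminf_finite)
    show "finite {k. real (Suc k) \<le> x}"
      by (rule finite_subset[of _ "{..nat \<lfloor>x\<rfloor>}"]) (auto simp: le_nat_floor)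
    show "prime_sum (x / real (Suc k)) = 0" if "k \<notin> {k. real (Suc k) \<le> x}" for k
      using that by (intro prime_sum_less_one) (simp add: divide_less_eq)
  qed
  also have "\<dots> = (\<Sum>m | 1 \<le> m \<and> real m \<le> x. prime_sum (x / real m))"
    by (rule sum.reindex_bij_witness[where i = "\<lambda>m. m - 1" and j = Suc]) auto
  finally show ?thesis using sum_prime_factors_eq_sum_prime_sum[OF x] by simp
qed

text \<open>
  The argument \<open>2 * y\<close> of the logarithm keeps the denominator away from \<open>0\<close>, so that the bound
  holds down to \<open>y = 1\<close>. This uniformity is needed because \<open>y = x / m\<close> ranges down to \<open>1\<close> below.
\<close>

lemma prime_sum_bound:
  "\<exists>C>0. \<forall>y\<ge>1. prime_sum y \<le> C * y\<^sup>2 / ln (2 * y)"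
proof -
  have "((\<lambda>y::real. prime_sum y * ln y / y\<^sup>2 * (ln (2 * y) / ln y)) \<longlongrightarrow> 1 / 2 * 1) at_top"
    by (intro tendsto_mult prime_sum_asymptotics) real_asymp
  hence "\<forall>\<^sub>F y in at_top. prime_sum y * ln y / y\<^sup>2 * (ln (2 * y) / ln y) < 1"
    by (rule order_tendstoD(2)) simp
  then obtain Y where Y: "\<And>y. y \<ge> Y \<Longrightarrow> prime_sum y * ln y / y\<^sup>2 * (ln (2 * y) / ln y) < 1"
    by (auto simp: eventually_at_top_linorder)
  define Z where "Z = max Y 2"
  define C where "C = max 1 (ln (2 * Z))"
  have "prime_sum y \<le> C * y\<^sup>2 / ln (2 * y)" if y: "y \<ge> 1" for y
  proof -
    have l: "ln (2 * y) > 0" using y by simp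
    have "prime_sum y * ln (2 * y) \<le> C * y\<^sup>2"
    proof (cases "y \<ge> Z")
      case True
      hence "ln y > 0" "y > 0" by (auto simp: Z_def)
      hence "prime_sum y * ln y / y\<^sup>2 * (ln (2 * y) / ln y) = prime_sum y * ln (2 * y) / y\<^sup>2" by simp
      hence "prime_sum y * ln (2 * y) / y\<^sup>2 < 1" using Y[of y] True by (simp add: Z_def)
      hence "prime_sum y * ln (2 * y) < 1 * y\<^sup>2" using \<open>y > 0\<close> by (simp add: divide_less_eq)
      also have "\<dots> \<le> C * y\<^sup>2" by (intro mult_right_mono) (auto simp: C_def)
      finally show ?thesis by simp
    next
      case False
      have "ln (2 * y) \<le> ln (2 * Z)" using False y by (intro ln_mono) auto
      hence "ln (2 * y) \<le> C" by (simp add: C_def)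
      hence "prime_sum y * ln (2 * y) \<le> y\<^sup>2 * C"
        using y l by (intro mult_mono prime_sum_le_square) auto
      thus ?thesis by (simp add: mult.commute)
    qed
    thus ?thesis using l by (simp add: pos_le_divide_eq)
  qed
  moreover have "C > 0" by (simp add: C_def)
  ultimately show ?thesis by blast
qed

text \<open>
  The dominating series for Tannery's theorem. With \<open>m = Suc k\<close>, the bound on \<open>prime_sum (x / m)\<close>
  loses the factor \<open>ln x / ln (2 * x / m)\<close> against \<open>1 / m\<^sup>2\<close>. This factor grows at most like
  \<open>ln m\<close> and is therefore absorbed by \<open>5 * sqrt m\<close>.
\<close>

lemma prime_sum_quotient_bound:
  assumes C: "C > 0" "\<And>y. y \<ge> 1 \<Longrightarrow> prime_sum y \<le> C * y\<^sup>2 / ln (2 * y)"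
    and x: "x \<ge> 1"
  shows "norm (prime_sum (x / real (Suc k)) * ln x / x\<^sup>2) \<le> 5 * C * real (Suc k) powr (-(3/2))"
proof -
  define m where "m = real (Suc k)"
  have m: "m \<ge> 1" by (simp add: m_def)
  have lx: "ln x \<ge> 0" using x by simp
  have "prime_sum (x / m) * ln x / x\<^sup>2 \<le> 5 * C * m powr (-(3/2))"
  proof (cases "x / m < 1")
    case True
    thus ?thesis using C by (simp add: prime_sum_less_one)
  next
    case False
    hence xm: "x / m \<ge> 1" by simp
    have l2: "ln (2::real) \<ge> 1 / 2" using ln_le_minus_one[of "1 / 2"] by (simp add: ln_div)
    have L: "ln (2 * (x / m)) \<ge> ln 2" using xm by (intro ln_mono) auto
    have "ln x \<le> ln (2 * x)" using x by (intro ln_mono) auto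
    also have "\<dots> = ln (2 * (x / m)) + ln m" using x m by (simp add: ln_mult ln_div)
    finally have lnx: "ln x \<le> ln (2 * (x / m)) + ln m" .
    have "ln m \<le> m powr (1/2) / (1/2)" using m by (intro ln_powr_bound) auto
    also have "\<dots> \<le> 4 * m powr (1/2) * ln (2 * (x / m))"
    proof -
      have "4 * m powr (1/2) * (1 / 2) \<le> 4 * m powr (1/2) * ln (2 * (x / m))"
        using L l2 by (intro mult_left_mono) auto
      thus ?thesis by simp
    qed
    moreover have "ln (2 * (x / m)) * 1 \<le> ln (2 * (x / m)) * m powr (1/2)"
      using L l2 m by (intro mult_left_mono ge_one_powr_ge_zero) auto
    moreover have "5 * m powr (1/2) * ln (2 * (x / m)) = 4 * m powr (1/2) * ln (2 * (x / m)) + ln (2 * (x / m)) * m powr (1/2)"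
      by simp
    ultimately have lnx': "ln x \<le> 5 * m powr (1/2) * ln (2 * (x / m))"
      using lnx unfolding mult_1_right by linarith
    have "prime_sum (x / m) * ln x \<le> (C * (x / m)\<^sup>2 / ln (2 * (x / m))) * (5 * m powr (1/2) * ln (2 * (x / m)))"
      using lx L l2 C(1) by (intro mult_mono C(2) xm lnx') auto
    also have "\<dots> = 5 * C * m powr (1/2) * (x / m)\<^sup>2" using L l2 by simp
    finally have "prime_sum (x / m) * ln x / x\<^sup>2 \<le> 5 * C * m powr (1/2) * (x / m)\<^sup>2 / x\<^sup>2"
      by (rule divide_right_mono) simp
    also have "\<dots> = 5 * C * (m powr (1/2) / m\<^sup>2)" using x by (simp add: power_divide)
    also have "m powr (1/2) / m\<^sup>2 = m powr (1/2 - 2)"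
      using m powr_diff[of m "1/2" 2] by simp
    finally show ?thesis by simp
  qed
  moreover have "0 \<le> prime_sum (x / m) * ln x / x\<^sup>2"
    using lx by (intro divide_nonneg_nonneg mult_nonneg_nonneg prime_sum_nonneg) auto
  ultimately show ?thesis by (simp add: m_def)
qed

lemma prime_sum_dilate_asymptotics:
  assumes c: "c > 0"
  shows "((\<lambda>x. prime_sum (x / c) * ln x / x\<^sup>2) \<longlongrightarrow> 1 / 2 * (1 / c\<^sup>2)) at_top"
proof -
  have "filterlim (\<lambda>x. x / c) at_top at_top" using c by real_asymp
  note lim = filterlim_compose[OF prime_sum_asymptotics this]
  have "((\<lambda>x. (ln x / ln (x / c)) * (1 / c\<^sup>2)) \<longlongrightarrow> 1 * (1 / c\<^sup>2)) at_top"
    using c by (intro tendsto_mult tendsto_const) real_asymp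
  from tendsto_mult[OF lim this]
  have "((\<lambda>x. prime_sum (x / c) * ln (x / c) / (x / c)\<^sup>2 * ((ln x / ln (x / c)) * (1 / c\<^sup>2))) \<longlongrightarrow> 1 / 2 * (1 / c\<^sup>2)) at_top"
    by simp
  thus ?thesis
  proof (rule Lim_transform_eventually)
    show "\<forall>\<^sub>F x in at_top. prime_sum (x / c) * ln (x / c) / (x / c)\<^sup>2 * ((ln x / ln (x / c)) * (1 / c\<^sup>2)) = prime_sum (x / c) * ln x / x\<^sup>2"
      using eventually_gt_at_top[of c]
    proof eventually_elim
      case (elim x)
      hence "ln (x / c) > 0" "x > 0" using c by auto
      thus ?case using c by (simp add: power_divide)
    qed
  qed
qed

lemma sum_prime_factors_asymptotics:
  "((\<lambda>x. (\<Sum>n | 1 \<le> n \<and> real n \<le> x. \<Sum>p\<in>prime_factors n. real p) * ln x / x\<^sup>2) \<longlongrightarrow> pi\<^sup>2 / 12) at_top"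
proof -
  obtain C where "C > 0" and "\<forall>y\<ge>1. prime_sum y \<le> C * y\<^sup>2 / ln (2 * y)"
    using prime_sum_bound by (elim exE conjE) (rule that)
  hence C: "C > 0" "\<And>y. y \<ge> 1 \<Longrightarrow> prime_sum y \<le> C * y\<^sup>2 / ln (2 * y)" by simp_all
  let ?a = "\<lambda>k x. prime_sum (x / real (Suc k)) * ln x / x\<^sup>2"
  let ?b = "\<lambda>k. 1 / 2 * (1 / (real (Suc k))\<^sup>2)"
  have "((\<lambda>x. \<Sum>k. ?a k x) \<longlongrightarrow> (\<Sum>k. ?b k)) at_top"
  proof (rule tannerys_theorem[THEN conjunct2, THEN conjunct2])
    show "(?a k \<longlongrightarrow> ?b k) at_top" for k by (rule prime_sum_dilate_asymptotics) simp
    show "summable (\<lambda>k. 5 * C * real (Suc k) powr (-(3/2)))"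
      by (intro summable_mult summable_Suc_powr) simp
    have "\<forall>\<^sub>F (k, x) in sequentially \<times>\<^sub>F at_top. x \<ge> (1::real)"
      using eventually_prod2[of sequentially "\<lambda>x::real. x \<ge> 1" at_top] eventually_ge_at_top[of "1::real"]
      by (simp add: case_prod_unfold)
    thus "\<forall>\<^sub>F (k, x) in sequentially \<times>\<^sub>F at_top. norm (?a k x) \<le> 5 * C * real (Suc k) powr (-(3/2))"
      by eventually_elim (use prime_sum_quotient_bound[OF C] in auto)
  qed simp
  also have "(\<Sum>k. ?b k) = pi\<^sup>2 / 12"
    using sums_mult[OF inverse_squares_sums, of "1/2"] by (simp add: sums_iff add.commute)
  finally have lim: "((\<lambda>x. \<Sum>k. ?a k x) \<longlongrightarrow> pi\<^sup>2 / 12) at_top" .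
  have "\<forall>\<^sub>F x in at_top. (\<Sum>k. ?a k x) = (\<Sum>n | 1 \<le> n \<and> real n \<le> x. \<Sum>p\<in>prime_factors n. real p) * ln x / x\<^sup>2"
    using eventually_ge_at_top[of 0]
  proof eventually_elim
    case (elim x)
    have "summable (\<lambda>k. prime_sum (x / real (Suc k)))"
    proof (rule summable_finite)
      show "finite {k. real (Suc k) \<le> x}"
        by (rule finite_subset[of _ "{..nat \<lfloor>x\<rfloor>}"]) (auto simp: le_nat_floor)
      show "prime_sum (x / real (Suc k)) = 0" if "k \<notin> {k. real (Suc k) \<le> x}" for k
        using that by (intro prime_sum_less_one) (simp add: divide_less_eq)
    qed
    from suminf_mult2[OF this, of "ln x / x\<^sup>2", symmetric] show ?case
      unfolding sum_prime_factors_eq_suminf[OF elim] times_divide_eq_right .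
  qed
  with lim show ?thesis by (rule Lim_transform_eventually)
qed

text \<open>
  Each prime factor is at least \<open>2\<close>.
\<close>

lemma sum_multiplicity_le_log:
  assumes "n > (0::nat)"
  shows "real (\<Sum>p\<in>prime_factors n. multiplicity p n) \<le> log 2 (real n)"
proof -
  have "2 ^ (\<Sum>p\<in>prime_factors n. multiplicity p n) = (\<Prod>p\<in>prime_factors n. 2 ^ multiplicity p n :: nat)"
    by (rule power_sum)
  also have "\<dots> \<le> (\<Prod>p\<in>prime_factors n. p ^ multiplicity p n)"
    by (intro prod_mono conjI power_mono) (auto simp: in_prime_factors_iff prime_ge_2_nat)
  also have "\<dots> = n" using prime_factorization_nat[OF assms] by simp
  finally have "2 ^ (\<Sum>p\<in>prime_factors n. multiplicity p n) \<le> real n"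
    by (metis of_nat_le_iff of_nat_numeral of_nat_power)
  thus ?thesis using assms by (simp add: le_log_iff powr_realpow del: of_nat_sum)
qed

text \<open>
  Only primes with \<open>p\<^sup>2 dvd n\<close> are counted more than once; they satisfy \<open>p \<le> sqrt n\<close>, and all
  multiplicities together are at most \<open>log 2 n\<close>.
\<close>

lemma sopfr_minus_sum_prime_factors:
  assumes n: "n > 0"
  shows "(\<Sum>p\<in>prime_factors n. real p) \<le> real (sopfr n)"
    and "real (sopfr n) \<le> (\<Sum>p\<in>prime_factors n. real p) + sqrt (real n) * log 2 (real n)"
proof -
  have v: "multiplicity p n \<ge> 1" if "p \<in> prime_factors n" for p
    using that by (simp add: prime_factors_multiplicity Suc_le_eq)
  have "(\<Sum>p\<in>prime_factors n. 1 * real p) \<le> (\<Sum>p\<in>prime_factors n. real (multiplicity p n) * real p)"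
    using v by (intro sum_mono mult_right_mono) auto
  thus "(\<Sum>p\<in>prime_factors n. real p) \<le> real (sopfr n)" by (simp add: sopfr_def)
  have "real (multiplicity p n) * real p \<le> real p + sqrt (real n) * real (multiplicity p n)"
    if p: "p \<in> prime_factors n" for p
  proof (cases "multiplicity p n \<ge> 2")
    case True
    hence "p ^ 2 dvd n" by (rule multiplicity_dvd')
    hence "p ^ 2 \<le> n" using n by (intro dvd_imp_le)
    hence "real p ^ 2 \<le> real n" by (simp flip: of_nat_power)
    hence "real p \<le> sqrt (real n)" by (rule real_le_rsqrt)
    hence "real (multiplicity p n) * real p \<le> real (multiplicity p n) * sqrt (real n)"
      by (intro mult_left_mono) auto
    also have "\<dots> \<le> real p + sqrt (real n) * real (multiplicity p n)" by simp
    finally show ?thesis .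
  next
    case False
    hence "multiplicity p n = 1" using v[OF p] by simp
    thus ?thesis by simp
  qed
  hence "real (sopfr n) \<le> (\<Sum>p\<in>prime_factors n. real p + sqrt (real n) * real (multiplicity p n))"
    unfolding sopfr_def of_nat_sum of_nat_mult by (intro sum_mono)
  also have "\<dots> = (\<Sum>p\<in>prime_factors n. real p) + sqrt (real n) * real (\<Sum>p\<in>prime_factors n. multiplicity p n)"
    by (simp add: sum.distrib sum_distrib_left)
  also have "\<dots> \<le> (\<Sum>p\<in>prime_factors n. real p) + sqrt (real n) * log 2 (real n)"
    by (intro add_left_mono mult_left_mono sum_multiplicity_le_log n) auto
  finally show "real (sopfr n) \<le> (\<Sum>p\<in>prime_factors n. real p) + sqrt (real n) * log 2 (real n)" .
qed

lemma sopfr_sum_asymptotics: "((\<lambda>x. sopfr_sum x * ln x / x\<^sup>2) \<longlongrightarrow> pi\<^sup>2 / 12) at_top"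
proof (rule tendsto_sandwich)
  let ?N = "\<lambda>x. {n::nat. 1 \<le> n \<and> real n \<le> x}"
  let ?S = "\<lambda>x. \<Sum>n\<in>?N x. \<Sum>p\<in>prime_factors n. real p"
  show lim: "((\<lambda>x. ?S x * ln x / x\<^sup>2) \<longlongrightarrow> pi\<^sup>2 / 12) at_top" by (rule sum_prime_factors_asymptotics)
  have "((\<lambda>x::real. x * (sqrt x * log 2 x) * ln x / x\<^sup>2) \<longlongrightarrow> 0) at_top" by real_asymp
  from tendsto_add[OF lim this]
  show "((\<lambda>x. ?S x * ln x / x\<^sup>2 + x * (sqrt x * log 2 x) * ln x / x\<^sup>2) \<longlongrightarrow> pi\<^sup>2 / 12) at_top" by simp
  show "\<forall>\<^sub>F x in at_top. ?S x * ln x / x\<^sup>2 \<le> sopfr_sum x * ln x / x\<^sup>2"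
    using eventually_ge_at_top[of 1]
  proof eventually_elim
    case (elim x)
    have "?S x \<le> sopfr_sum x" unfolding sopfr_sum_def
      by (intro sum_mono sopfr_minus_sum_prime_factors(1)) auto
    thus ?case using elim by (intro divide_right_mono mult_right_mono) auto
  qed
  show "\<forall>\<^sub>F x in at_top. sopfr_sum x * ln x / x\<^sup>2 \<le> ?S x * ln x / x\<^sup>2 + x * (sqrt x * log 2 x) * ln x / x\<^sup>2"
    using eventually_ge_at_top[of 1]
  proof eventually_elim
    case (elim x)
    have "sopfr_sum x \<le> (\<Sum>n\<in>?N x. (\<Sum>p\<in>prime_factors n. real p) + sqrt x * log 2 x)"
      unfolding sopfr_sum_def
    proof (intro sum_mono)
      fix n assume n: "n \<in> ?N x"
      have "sqrt (real n) * log 2 (real n) \<le> sqrt x * log 2 x"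
        using n by (intro mult_mono) auto
      thus "real (sopfr n) \<le> (\<Sum>p\<in>prime_factors n. real p) + sqrt x * log 2 x"
        using sopfr_minus_sum_prime_factors(2)[of n] n by simp
    qed
    also have "\<dots> = ?S x + real (card (?N x)) * (sqrt x * log 2 x)" by (simp add: sum.distrib)
    also have "\<dots> \<le> ?S x + x * (sqrt x * log 2 x)"
    proof (intro add_left_mono mult_right_mono)
      have "card (?N x) \<le> card {1..nat \<lfloor>x\<rfloor>}" by (intro card_mono) (auto simp: le_nat_floor)
      hence "real (card (?N x)) \<le> real (nat \<lfloor>x\<rfloor>)" by simp
      also have "\<dots> \<le> x" using elim by (intro of_nat_floor) auto
      finally show "real (card (?N x)) \<le> x" .
    qed (use elim in auto)
    finally have "sopfr_sum x * ln x / x\<^sup>2 \<le> (?S x + x * (sqrt x * log 2 x)) * ln x / x\<^sup>2"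
      using elim by (intro divide_right_mono mult_right_mono) auto
    thus ?case by (simp only: distrib_right add_divide_distrib)
  qed
qed

theorem corollary1p2:
  shows "((\<lambda>x::real. sopfr_sum x / (pi\<^sup>2 / 6 * prime_sum x)) \<longlongrightarrow> 1) at_top"
proof -
  have "((\<lambda>x. (sopfr_sum x * ln x / x\<^sup>2) / (pi\<^sup>2 / 6 * (prime_sum x * ln x / x\<^sup>2))) \<longlongrightarrow>
      (pi\<^sup>2 / 12) / (pi\<^sup>2 / 6 * (1 / 2))) at_top"
    by (intro tendsto_divide tendsto_mult tendsto_const sopfr_sum_asymptotics prime_sum_asymptotics) simp
  hence "((\<lambda>x. (sopfr_sum x * ln x / x\<^sup>2) / (pi\<^sup>2 / 6 * (prime_sum x * ln x / x\<^sup>2))) \<longlongrightarrow> 1) at_top"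
    by simp
  thus ?thesis
  proof (rule Lim_transform_eventually)
    show "\<forall>\<^sub>F x in at_top. (sopfr_sum x * ln x / x\<^sup>2) / (pi\<^sup>2 / 6 * (prime_sum x * ln x / x\<^sup>2))
        = sopfr_sum x / (pi\<^sup>2 / 6 * prime_sum x)"
      using eventually_gt_at_top[of 1]
    proof eventually_elim
      case (elim x)
      define c where "c = ln x / x\<^sup>2"
      have "c \<noteq> 0" using elim by (simp add: c_def)
      hence "(sopfr_sum x * c) / (pi\<^sup>2 / 6 * prime_sum x * c) = sopfr_sum x / (pi\<^sup>2 / 6 * prime_sum x)"
        by (rule nonzero_mult_divide_mult_cancel_right)
      thus ?case by (simp only: c_def times_divide_eq_right mult.assoc)
    qed
  qed
qed

end
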